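(* Let $\theta>0$ and let $\mu$ be a probability distribution on $(0,\infty)$ with no mass at its essential supremum $\operatorname{ess\,sup}\mu\in(0,\infty]$ (a condition that holds automatically if the essential supremum is infinite). Let $(S_i(n)\colon i\ge1)_{n\ge0}$ be the disordered Chinese restaurant process with parameter $\theta$ and weight distribution $\mu$. Then: (i) The number $K_n$ of occupied tables at time $n$ satisfies $$\lim_{n\to\infty}\frac{K_n}{\log n}=\frac{\theta}{\operatorname{ess\,sup}\mu}\quad\text{almost surely},$$ where the right-hand side is interpreted as $0$ if $\operatorname{ess\,sup}\mu=\infty$. (ii) For every $k\ge1$, $S_k(n)\to\infty$ and $\frac{S_k(n)}{n}\to0$ almost surely as $n\to\infty$. (iii) Let $B_n$ be the time at which the most occupied table at time $n$ gets its first occupancy. Then $B_n\to\infty$ almost surely as $n\to\infty$. (iv) Almost surely, the proportion of customers at the largest table, $\max_{i\ge1}\frac{S_i(n)}{n}$, does not converge to one as $n\to\infty$.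
   Context: **Model.** Sample i.i.d. weights $(W_i)_{i\ge1}$ with distribution $\mu$. Given the weights, $(S_i(n)\colon i\ge1)_{n\ge0}$ is the Markov chain with $S_1(0)=1$ and $S_i(0)=0$ for $i\ge2$, and the following transitions. Let $K_n=\max\{i\ge1\colon S_i(n)\ne0\}$ be the number of occupied tables at time $n$. Given the configuration at time $n$: for each $i\le K_n$, with probability proportional to $W_iS_i(n)$, one has $S_i(n+1)=S_i(n)+1$ and all other coordinates are unchanged; with probability proportional to $\theta$, one has $S_{K_n+1}(n+1)=1$ and all other coordinates are unchanged. ($S_i(n)$ is the number of customers at table $i$ at time $n$.) Ties for the most occupied table may be broken in any way. The time at which table $i$ gets its first occupancy is $\min\{m\colon S_i(m)\ge1\}$. *)

theory Defs
  imports "HOL-Probability.Probability"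
begin

text \<open>
  Tables are numbered from 1; index 0 of \<open>W\<close> and \<open>S\<close> is never referred to.
  \<open>S i n \<omega>\<close> is the number of customers at table \<open>i\<close> at time \<open>n\<close>.
  The set in \<open>num_tables\<close> is almost surely finite and nonempty in the process below.
\<close>

definition num_tables :: "(nat \<Rightarrow> nat \<Rightarrow> 'a \<Rightarrow> nat) \<Rightarrow> nat \<Rightarrow> 'a \<Rightarrow> nat" where
  "num_tables S n \<omega> = Max {i. 1 \<le> i \<and> S i n \<omega> \<noteq> 0}"

definition total_rate ::
  "real \<Rightarrow> (nat \<Rightarrow> 'a \<Rightarrow> real) \<Rightarrow> (nat \<Rightarrow> nat \<Rightarrow> 'a \<Rightarrow> nat) \<Rightarrow> nat \<Rightarrow> 'a \<Rightarrow> real" where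
  "total_rate \<theta> W S n \<omega> = \<theta> + (\<Sum>i = 1..num_tables S n \<omega>. W i \<omega> * real (S i n \<omega>))"

text \<open>The sigma-algebra generated by all the weights and by the configurations up to time \<open>n\<close>.\<close>

definition history ::
  "'a measure \<Rightarrow> (nat \<Rightarrow> 'a \<Rightarrow> real) \<Rightarrow> (nat \<Rightarrow> nat \<Rightarrow> 'a \<Rightarrow> nat) \<Rightarrow> nat \<Rightarrow> 'a measure" where
  "history M W S n = sigma (space M)
     ((\<Union>i\<in>{1..}. sets (vimage_algebra (space M) (W i) borel)) \<union>
      (\<Union>i\<in>{1..}. \<Union>m\<in>{..n}. sets (vimage_algebra (space M) (S i m) (count_space UNIV))))"

definition joins_table ::
  "'a measure \<Rightarrow> (nat \<Rightarrow> nat \<Rightarrow> 'a \<Rightarrow> nat) \<Rightarrow> nat \<Rightarrow> nat \<Rightarrow> 'a set" where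
  "joins_table M S n i = {\<omega> \<in> space M. S i (Suc n) \<omega> = S i n \<omega> + 1 \<and>
     (\<forall>j\<ge>1. j \<noteq> i \<longrightarrow> S j (Suc n) \<omega> = S j n \<omega>)}"

definition opens_table ::
  "'a measure \<Rightarrow> (nat \<Rightarrow> nat \<Rightarrow> 'a \<Rightarrow> nat) \<Rightarrow> nat \<Rightarrow> 'a set" where
  "opens_table M S n = {\<omega> \<in> space M. S (num_tables S n \<omega> + 1) (Suc n) \<omega> = 1 \<and>
     (\<forall>j\<ge>1. j \<noteq> num_tables S n \<omega> + 1 \<longrightarrow> S j (Suc n) \<omega> = S j n \<omega>)}"

text \<open>
  That \<open>S\<close> is, given the weights, a Markov chain with the stated transitions is expressed by
  prescribing the conditional law of the step from \<open>n\<close> to \<open>n + 1\<close> given all the weights and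
  the configurations at times \<open>0, \<dots>, n\<close>.
\<close>

locale disordered_CRP = prob_space M
  for M :: "'a measure" and \<theta> :: real and \<mu> :: "real measure"
    and W :: "nat \<Rightarrow> 'a \<Rightarrow> real" and S :: "nat \<Rightarrow> nat \<Rightarrow> 'a \<Rightarrow> nat" +
  assumes weights_indep: "indep_vars (\<lambda>_. borel) W {1..}"
    and weights_distr: "\<And>i. 1 \<le> i \<Longrightarrow> distr M borel (W i) = \<mu>"
    and S_measurable: "\<And>i n. 1 \<le> i \<Longrightarrow> S i n \<in> measurable M (count_space UNIV)"
    and S_init: "AE \<omega> in M. S 1 0 \<omega> = 1 \<and> (\<forall>i\<ge>2. S i 0 \<omega> = 0)"
    and prob_joins: "\<And>n i. 1 \<le> i \<Longrightarrow>
      AE \<omega> in M. i \<le> num_tables S n \<omega> \<longrightarrow>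
        real_cond_exp M (history M W S n) (indicator (joins_table M S n i)) \<omega>
          = W i \<omega> * real (S i n \<omega>) / total_rate \<theta> W S n \<omega>"
    and prob_opens: "\<And>n.
      AE \<omega> in M.
        real_cond_exp M (history M W S n) (indicator (opens_table M S n)) \<omega>
          = \<theta> / total_rate \<theta> W S n \<omega>"

definition most_occupied :: "(nat \<Rightarrow> nat \<Rightarrow> 'a \<Rightarrow> nat) \<Rightarrow> nat \<Rightarrow> 'a \<Rightarrow> nat \<Rightarrow> bool" where
  "most_occupied S n \<omega> i \<longleftrightarrow> 1 \<le> i \<and> (\<forall>j\<ge>1. S j n \<omega> \<le> S i n \<omega>)"

definition first_occupancy :: "(nat \<Rightarrow> nat \<Rightarrow> 'a \<Rightarrow> nat) \<Rightarrow> nat \<Rightarrow> 'a \<Rightarrow> nat" where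
  "first_occupancy S i \<omega> = (LEAST m. 1 \<le> S i m \<omega>)"

end

theory Submission imports Defs begin

text \<open>
  Let \<open>K n\<close> be the number of tables, \<open>R n\<close> the total rate and \<open>A n = (\<Sum>m<n. 1 / R m)\<close>. In the
  natural clock \<open>A\<close>, tables open at rate \<open>\<theta>\<close> and table \<open>j\<close> grows exponentially at rate \<open>W j\<close>.
  This is made precise by three families of nonnegative supermartingales, which are almost surely
  bounded by the maximal inequality, so that no martingale convergence theorem is needed:
  \<^item> \<open>exp (c * K n - (exp c - 1) * \<theta> * A n)\<close> with \<open>c\<close> of either sign gives \<open>K n \<sim> \<theta> * A n\<close>;
  \<^item> \<open>exp (m / (m + 1) * W j * A n) / S j n\<close>, from the time when \<open>S j \<ge> m\<close>, bounds table \<open>j\<close> from below;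
  \<^item> \<open>(L n + \<theta> / v) * exp (- v * A n)\<close> bounds from above the number \<open>L n\<close> of customers at tables of
    weight less than \<open>v\<close>.

  If \<open>K\<close> were bounded then \<open>R n = O(n)\<close>, so \<open>A\<close> would diverge and with it \<open>K\<close>; hence \<open>A\<close> tends to
  infinity. For every \<open>v < esssup \<mu>\<close> some table \<open>j\<close> has \<open>W j > v\<close>, so that \<open>L n / S j n\<close> vanishes. Thus every
  table is eventually negligible, the leader changes infinitely often (and at a change of leader
  the leader holds about half of the customers at most), and \<open>R n / n\<close> tends to \<open>esssup \<mu>\<close>, whence
  \<open>A n \<sim> ln n / esssup \<mu>\<close>.
\<close>

section \<open>Analytic preliminaries\<close>

text \<open>The difference of \<open>harm n\<close> and \<open>ln n\<close> converges to the
  Euler-Mascheroni constant, while \<open>ln n\<close> diverges.\<close>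

lemma harm_over_ln: "(\<lambda>n. harm n / ln (real n) :: real) \<longlonglongrightarrow> 1"
proof -
  have "(\<lambda>n. (harm n - ln (real n)) / ln (real n) + 1) \<longlonglongrightarrow> 0 + 1"
    by (intro tendsto_add tendsto_const tendsto_divide_0[OF euler_mascheroni_LIMSEQ]
        filterlim_at_top_imp_at_infinity filterlim_compose[OF ln_at_top] filterlim_real_sequentially)
  then have "(\<lambda>n. (harm n - ln (real n)) / ln (real n) + 1) \<longlonglongrightarrow> (1::real)" by simp
  then show ?thesis
  proof (rule Lim_transform_eventually)
    show "eventually (\<lambda>n. (harm n - ln (real n)) / ln (real n) + 1 = harm n / ln (real n)) sequentially"
      using eventually_gt_at_top[of 1] by eventually_elim (simp add: field_simps)
  qed
qed

lemma affine_harm_over_ln: "(\<lambda>n. (a * harm n + b) / ln (real n)) \<longlonglongrightarrow> (a::real)"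
proof -
  have "(\<lambda>n. a * (harm n / ln (real n)) + b / ln (real n)) \<longlonglongrightarrow> a * 1 + 0"
    by (intro tendsto_add tendsto_mult tendsto_const harm_over_ln tendsto_divide_0[OF tendsto_const]
        filterlim_at_top_imp_at_infinity filterlim_compose[OF ln_at_top] filterlim_real_sequentially)
  then show ?thesis by (simp add: add_divide_distrib)
qed

text \<open>The derivative of \<open>exp\<close> at zero, taken along \<sigma> / (q + 1). It shows
  that the exponential bounds on the number of tables become sharp as \<open>q\<close>
  grows.\<close>

lemma exp_difference_quotient:
  assumes "\<sigma> \<noteq> 0"
  shows "(\<lambda>q. real (Suc q) * ((exp (\<sigma> / Suc q) - 1) / \<sigma>)) \<longlonglongrightarrow> 1"
proof -
  have "((\<lambda>x::real. (exp x - 1) / x) \<longlongrightarrow> 1) (at 0)"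
    using DERIV_exp[of "0::real"] by (simp add: DERIV_def)
  moreover have "filterlim (\<lambda>q. \<sigma> / real (Suc q)) (at 0) sequentially"
    unfolding filterlim_at using assms
    by (auto intro!: tendsto_divide_0[OF tendsto_const] filterlim_at_top_imp_at_infinity
         filterlim_compose[OF filterlim_real_sequentially] filterlim_Suc simp del: of_nat_Suc)
  ultimately have "(\<lambda>q. (exp (\<sigma> / real (Suc q)) - 1) / (\<sigma> / real (Suc q))) \<longlonglongrightarrow> 1"
    by (rule filterlim_compose)
  then show ?thesis by (simp add: mult.commute)
qed

lemma sum_of_bool_eq: "i \<in> {1..k} \<Longrightarrow> (\<Sum>j = 1..k. f j * of_bool (j = i)) = (f (i::nat) :: 'b::comm_semiring_1)"
  by (simp add: of_bool_def if_distrib cong: if_cong)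

section \<open>A maximal inequality\<close>

text \<open>Doob's maximal inequality: \<open>r\<close> times the probability of reaching level
  \<open>r\<close> is at most the initial expectation, uniformly in time; then \<open>r\<close>
  tends to infinity. Since \<open>ennreal\<close> truncates at zero, \<open>decr\<close> and
  \<open>init\<close> speak of positive parts.\<close>

lemma (in prob_space) supermartingale_bounded:
  fixes X :: "nat \<Rightarrow> 'a \<Rightarrow> real" and G :: "nat \<Rightarrow> 'a measure"
  assumes sub: "\<And>n. subalgebra M (G n)"
    and filt: "\<And>n. sets (G n) \<subseteq> sets (G (Suc n))"
    and X: "\<And>n. X n \<in> borel_measurable (G n)"
    and decr: "\<And>n B. B \<in> sets (G n) \<Longrightarrow>
      (\<integral>\<^sup>+\<omega>\<in>B. ennreal (X (Suc n) \<omega>) \<partial>M) \<le> (\<integral>\<^sup>+\<omega>\<in>B. ennreal (X n \<omega>) \<partial>M)"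
    and init: "(\<integral>\<^sup>+\<omega>. ennreal (X 0 \<omega>) \<partial>M) < \<infinity>"
  shows "AE \<omega> in M. \<exists>C. \<forall>n. X n \<omega> \<le> C"
proof -
  have spG: "space (G n) = space M" for n using sub[of n] by (simp add: subalgebra_def)
  have GM: "A \<in> sets M" if "A \<in> sets (G n)" for A n using sub[of n] that by (auto simp: subalgebra_def)
  have XM [measurable]: "X n \<in> borel_measurable M" for n
    using measurable_from_subalg[OF sub X] .
  have filt_le: "sets (G m) \<subseteq> sets (G n)" if "m \<le> n" for m n
    using filt that by (rule lift_Suc_mono_le)
  have XG: "X m \<in> borel_measurable (G n)" if "m \<le> n" for m n
    using X[of m] filt_le[OF that] unfolding measurable_def spG by auto
  \<comment> \<open>\<open>C r n\<close> is the event that level \<open>r\<close> is reached by time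
    \<open>n\<close>, and \<open>B r n\<close> its complement.\<close>
  define B where "B r n = {\<omega> \<in> space M. \<forall>m\<le>n. X m \<omega> < r}" for r :: real and n
  define C where "C r n = {\<omega> \<in> space M. \<exists>m\<le>n. r \<le> X m \<omega>}" for r :: real and n
  have BG: "B r n \<in> sets (G n)" for r n
  proof -
    have "{\<omega> \<in> space (G n). X m \<omega> < r} \<in> sets (G n)" if "m \<le> n" for m
      using borel_measurable_less[OF XG[OF that], of "\<lambda>_. r"] by simp
    then have "(\<Inter>m\<in>{..n}. {\<omega> \<in> space (G n). X m \<omega> < r}) \<in> sets (G n)"
      by (intro sets.finite_INT) auto
    also have "(\<Inter>m\<in>{..n}. {\<omega> \<in> space (G n). X m \<omega> < r}) = B r n" by (auto simp: B_def spG)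
    finally show ?thesis .
  qed
  then have BM [measurable]: "B r n \<in> sets M" for r n using GM by blast
  have CM [measurable]: "C r n \<in> sets M" for r n unfolding C_def by measurable
  define E where "E = (\<integral>\<^sup>+\<omega>. ennreal (X 0 \<omega>) \<partial>M)"
  have bound: "ennreal r * emeasure M (C r n) \<le> E" if r: "0 < r" for r n
  proof -
    \<comment> \<open>The expectation of the process stopped on reaching \<open>r\<close>, with its
      value there cut down to \<open>r\<close>. This quantity does not increase in
      \<open>n\<close>.\<close>
    define P where "P n = (\<integral>\<^sup>+\<omega>. (ennreal r * indicator (C r n) \<omega> + ennreal (X n \<omega>) * indicator (B r n) \<omega>) \<partial>M)" for n
    have "P n \<le> E"
    proof (induction n)
      case 0
      show ?case unfolding P_def E_def
        by (intro nn_integral_mono) (auto simp: B_def C_def indicator_def intro: ennreal_leI)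
    next
      case (Suc n)
      \<comment> \<open>On a path leaving \<open>B r n\<close> at time \<open>Suc n\<close> the
        value of \<open>X\<close> is at least \<open>r\<close>, so counting it as \<open>r\<close>
        only lowers the integrand.\<close>
      have "P (Suc n) \<le> (\<integral>\<^sup>+\<omega>. (ennreal r * indicator (C r n) \<omega> + ennreal (X (Suc n) \<omega>) * indicator (B r n) \<omega>) \<partial>M)"
        unfolding P_def
      proof (intro nn_integral_mono)
        fix \<omega> assume w: "\<omega> \<in> space M"
        show "ennreal r * indicator (C r (Suc n)) \<omega> + ennreal (X (Suc n) \<omega>) * indicator (B r (Suc n)) \<omega>
          \<le> ennreal r * indicator (C r n) \<omega> + ennreal (X (Suc n) \<omega>) * indicator (B r n) \<omega>"
          using w by (auto simp: B_def C_def indicator_def le_Suc_eq not_less intro: ennreal_leI)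
      qed
      also have "\<dots> = (\<integral>\<^sup>+\<omega>. ennreal r * indicator (C r n) \<omega> \<partial>M) + (\<integral>\<^sup>+\<omega>\<in>B r n. ennreal (X (Suc n) \<omega>) \<partial>M)"
        by (intro nn_integral_add) measurable
      also have "\<dots> \<le> (\<integral>\<^sup>+\<omega>. ennreal r * indicator (C r n) \<omega> \<partial>M) + (\<integral>\<^sup>+\<omega>\<in>B r n. ennreal (X n \<omega>) \<partial>M)"
        by (intro add_left_mono decr BG)
      also have "\<dots> = P n" unfolding P_def by (intro nn_integral_add[symmetric]) measurable
      finally show ?case using Suc.IH by simp
    qed
    moreover have "(\<integral>\<^sup>+\<omega>. ennreal r * indicator (C r n) \<omega> \<partial>M) \<le> P n"
      unfolding P_def by (intro nn_integral_mono) simp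
    ultimately show ?thesis by (simp add: nn_integral_cmult_indicator)
  qed
  have bound': "ennreal r * emeasure M (\<Union>n. C r n) \<le> E" if r: "0 < r" for r
  proof -
    have "(SUP n. emeasure M (C r n)) = emeasure M (\<Union>n. C r n)"
      by (intro SUP_emeasure_incseq) (auto simp: incseq_def C_def intro: order_trans)
    then have "ennreal r * emeasure M (\<Union>n. C r n) = (SUP n. ennreal r * emeasure M (C r n))"
      by (simp only: SUP_mult_left_ennreal[symmetric])
    then show ?thesis using bound[OF r] by (simp add: SUP_le_iff)
  qed
  \<comment> \<open>The event that the process exceeds every level; by \<open>bound'\<close> at all
    levels \<open>Suc k\<close> it is null.\<close>
  define N where "N = (\<Inter>k::nat. \<Union>n. C (real (Suc k)) n)"
  have NM [measurable]: "N \<in> sets M" unfolding N_def by measurable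
  have "prob N = 0"
  proof (rule ccontr)
    assume "prob N \<noteq> 0"
    then have p: "0 < prob N" using measure_nonneg[of M N] by linarith
    obtain k :: nat where k: "enn2real E < real k * prob N" using reals_Archimedean3[OF p] by blast
    have "ennreal (real (Suc k)) * emeasure M N \<le> ennreal (real (Suc k)) * emeasure M (\<Union>n. C (real (Suc k)) n)"
      by (intro mult_left_mono emeasure_mono) (auto simp: N_def)
    also have "\<dots> \<le> E" by (rule bound') simp
    finally have "enn2real (ennreal (real (Suc k)) * emeasure M N) \<le> enn2real E"
      using init by (intro enn2real_mono) (auto simp: E_def)
    then have "real (Suc k) * prob N \<le> enn2real E"
      by (simp add: enn2real_mult measure_def del: of_nat_Suc)
    then show False using k p by (simp add: algebra_simps)
  qed
  then have "AE \<omega> in M. \<omega> \<notin> N"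
    by (intro AE_not_in) (simp add: null_sets_def emeasure_eq_measure)
  then show ?thesis
  proof (rule AE_mp, intro AE_I2 impI)
    fix \<omega> assume w: "\<omega> \<in> space M" "\<omega> \<notin> N"
    then obtain k where "\<And>n. \<omega> \<notin> C (real (Suc k)) n" by (auto simp: N_def)
    then have "X n \<omega> < real (Suc k)" for n using w(1) by (auto simp: C_def not_le)
    then show "\<exists>C. \<forall>n. X n \<omega> \<le> C" by (intro exI[of _ "real (Suc k)"]) (auto intro: less_imp_le)
  qed
qed

section \<open>Seating paths\<close>

text \<open>The index \<open>i\<close> may be the first empty table, so a single predicate covers
  both kinds of transition. No measure occurs in it, which allows paths to be studied one at a
  time.\<close>

definition seats_at :: "(nat \<Rightarrow> nat \<Rightarrow> 'a \<Rightarrow> nat) \<Rightarrow> nat \<Rightarrow> nat \<Rightarrow> 'a \<Rightarrow> bool" where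
  "seats_at S n i \<omega> \<longleftrightarrow> (\<forall>j\<ge>1. S j (Suc n) \<omega> = S j n \<omega> + of_bool (j = i))"

definition valid_start :: "(nat \<Rightarrow> nat \<Rightarrow> 'a \<Rightarrow> nat) \<Rightarrow> 'a \<Rightarrow> bool" where
  "valid_start S \<omega> \<longleftrightarrow> S 1 0 \<omega> = 1 \<and> (\<forall>i\<ge>2. S i 0 \<omega> = 0)"

text \<open>Opening a new table amounts to sitting at the first empty one, which has number \<open>num_tables + 1\<close>.\<close>

definition valid_step :: "(nat \<Rightarrow> nat \<Rightarrow> 'a \<Rightarrow> nat) \<Rightarrow> nat \<Rightarrow> 'a \<Rightarrow> bool" where
  "valid_step S n \<omega> \<longleftrightarrow> (\<exists>i\<in>{1..num_tables S n \<omega> + 1}. seats_at S n i \<omega>)"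

text \<open>The invariant of the dynamics. The occupied tables form a nonempty initial segment,
  which makes the \<open>Max\<close> in \<open>num_tables\<close> meaningful; the bound
  \<open>Suc n\<close> later lets sums over a random number of tables be written with a fixed
  range.\<close>

definition proper_seating :: "(nat \<Rightarrow> nat \<Rightarrow> 'a \<Rightarrow> nat) \<Rightarrow> nat \<Rightarrow> 'a \<Rightarrow> bool" where
  "proper_seating S n \<omega> \<longleftrightarrow> 1 \<le> num_tables S n \<omega> \<and> num_tables S n \<omega> \<le> Suc n \<and>
     (\<forall>i\<ge>1. S i n \<omega> \<noteq> 0 \<longleftrightarrow> i \<le> num_tables S n \<omega>) \<and>
     (\<Sum>i = 1..num_tables S n \<omega>. S i n \<omega>) = Suc n"

lemma num_tables_eqI:
  assumes "1 \<le> k" "\<And>i. 1 \<le> i \<Longrightarrow> S i n \<omega> \<noteq> 0 \<longleftrightarrow> i \<le> k"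
  shows "num_tables S n \<omega> = k"
proof -
  have "{i. 1 \<le> i \<and> S i n \<omega> \<noteq> 0} = {1..k}" using assms by auto
  moreover have "Max {1..k} = k" using assms(1) by (intro Max_eqI) auto
  ultimately show ?thesis by (simp only: num_tables_def)
qed

lemma num_tables_Suc:
  assumes "proper_seating S n \<omega>" "i \<in> {1..num_tables S n \<omega> + 1}" "seats_at S n i \<omega>"
  shows "num_tables S (Suc n) \<omega> = num_tables S n \<omega> + of_bool (i = num_tables S n \<omega> + 1)"
proof (rule num_tables_eqI)
  show "1 \<le> num_tables S n \<omega> + of_bool (i = num_tables S n \<omega> + 1)"
    using assms(1) by (auto simp: proper_seating_def)
next
  fix j :: nat assume j: "1 \<le> j"
  have nz: "S j n \<omega> \<noteq> 0 \<longleftrightarrow> j \<le> num_tables S n \<omega>"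
    using assms(1) j unfolding proper_seating_def by blast
  have "S j (Suc n) \<omega> = S j n \<omega> + of_bool (j = i)"
    using assms(3) j unfolding seats_at_def by blast
  then show "S j (Suc n) \<omega> \<noteq> 0 \<longleftrightarrow> j \<le> num_tables S n \<omega> + of_bool (i = num_tables S n \<omega> + 1)"
    using nz assms(2) by (cases "j = i") auto
qed

text \<open>One step changes a single summand. If a table opens, the range also grows by one, and
  \<open>g (num_tables S n \<omega> + 1) 0 = 0\<close> makes the additional old summand vanish. This
  serves for the count of all customers and of the light ones.\<close>

lemma proper_seating_sum:
  assumes "proper_seating S n \<omega>" "i \<in> {1..num_tables S n \<omega> + 1}" "seats_at S n i \<omega>"
    and "g (num_tables S n \<omega> + 1) 0 = 0"
  shows "(\<Sum>j = 1..num_tables S (Suc n) \<omega>. g j (S j (Suc n) \<omega>)) =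
    (\<Sum>j = 1..num_tables S n \<omega>. g j (S j n \<omega>)) + (g i (S i n \<omega> + 1) - g i (S i n \<omega>) :: real)"
proof -
  let ?K = "num_tables S n \<omega>"
  have z: "S (?K + 1) n \<omega> = 0"
    using assms(1) unfolding proper_seating_def by (metis Suc_eq_plus1 Suc_n_not_le_n le_add2)
  have s: "S j (Suc n) \<omega> = S j n \<omega> + of_bool (j = i)" if "1 \<le> j" for j
    using assms(3) that unfolding seats_at_def by blast
  have "(\<Sum>j = 1..num_tables S (Suc n) \<omega>. g j (S j (Suc n) \<omega>)) = (\<Sum>j = 1..?K + 1. g j (S j (Suc n) \<omega>))"
  proof (cases "i = ?K + 1")
    case False
    then have "S (?K + 1) (Suc n) \<omega> = 0" using s[of "?K+1"] z by simp
    then show ?thesis using num_tables_Suc[OF assms(1-3)] False assms(4) by simp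
  qed (use num_tables_Suc[OF assms(1-3)] in simp)
  also have "\<dots> = (\<Sum>j = 1..?K + 1. g j (S j n \<omega>) + (g j (S j n \<omega> + 1) - g j (S j n \<omega>)) * of_bool (j = i))"
    by (intro sum.cong refl) (use s in auto)
  also have "\<dots> = (\<Sum>j = 1..?K + 1. g j (S j n \<omega>)) + (g i (S i n \<omega> + 1) - g i (S i n \<omega>))"
    unfolding sum.distrib sum_of_bool_eq[OF assms(2)] ..
  finally show ?thesis using z assms(4) by simp
qed

lemma proper_seating_0:
  assumes "valid_start S \<omega>" shows "proper_seating S 0 \<omega>"
proof -
  have nz: "S i 0 \<omega> \<noteq> 0 \<longleftrightarrow> i \<le> 1" if "1 \<le> i" for i
    using assms that unfolding valid_start_def by (cases "i = 1") auto
  have "num_tables S 0 \<omega> = 1" by (rule num_tables_eqI) (use nz in auto)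
  then show ?thesis using nz assms by (simp add: proper_seating_def valid_start_def)
qed

lemma proper_seating_Suc:
  assumes "proper_seating S n \<omega>" "valid_step S n \<omega>"
  shows "proper_seating S (Suc n) \<omega>"
proof -
  obtain i where i: "i \<in> {1..num_tables S n \<omega> + 1}" "seats_at S n i \<omega>"
    using assms(2) unfolding valid_step_def by blast
  note K = num_tables_Suc[OF assms(1) i]
  have "S j (Suc n) \<omega> \<noteq> 0 \<longleftrightarrow> j \<le> num_tables S (Suc n) \<omega>" if j: "1 \<le> j" for j
  proof -
    have nz: "S j n \<omega> \<noteq> 0 \<longleftrightarrow> j \<le> num_tables S n \<omega>"
      using assms(1) j unfolding proper_seating_def by blast
    have "S j (Suc n) \<omega> = S j n \<omega> + of_bool (j = i)"
      using i(2) j unfolding seats_at_def by blast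
    then show ?thesis using nz i(1) K by (cases "j = i") auto
  qed
  moreover have "(\<Sum>j = 1..num_tables S (Suc n) \<omega>. S j (Suc n) \<omega>) = Suc (Suc n)"
  proof -
    have "real (\<Sum>j = 1..num_tables S (Suc n) \<omega>. S j (Suc n) \<omega>) = real (\<Sum>j = 1..num_tables S n \<omega>. S j n \<omega>) + 1"
      using proper_seating_sum[OF assms(1) i, of "\<lambda>_. real"] by simp
    then have "(\<Sum>j = 1..num_tables S (Suc n) \<omega>. S j (Suc n) \<omega>) = (\<Sum>j = 1..num_tables S n \<omega>. S j n \<omega>) + 1"
      by linarith
    then show ?thesis using assms(1) unfolding proper_seating_def by simp
  qed
  moreover have "1 \<le> num_tables S (Suc n) \<omega>" "num_tables S (Suc n) \<omega> \<le> Suc (Suc n)"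
    using K assms(1) unfolding proper_seating_def by auto
  ultimately show ?thesis unfolding proper_seating_def by blast
qed

section \<open>The clock and elementary properties of a fixed path\<close>

definition cum_rate :: "real \<Rightarrow> (nat \<Rightarrow> 'a \<Rightarrow> real) \<Rightarrow> (nat \<Rightarrow> nat \<Rightarrow> 'a \<Rightarrow> nat) \<Rightarrow> nat \<Rightarrow> 'a \<Rightarrow> real" where
  "cum_rate \<theta> W S n \<omega> = (\<Sum>m<n. 1 / total_rate \<theta> W S m \<omega>)"

definition light_customers :: "real \<Rightarrow> (nat \<Rightarrow> 'a \<Rightarrow> real) \<Rightarrow> (nat \<Rightarrow> nat \<Rightarrow> 'a \<Rightarrow> nat) \<Rightarrow> nat \<Rightarrow> 'a \<Rightarrow> real" where
  "light_customers v W S n \<omega> = (\<Sum>i = 1..num_tables S n \<omega>. of_bool (W i \<omega> < v) * real (S i n \<omega>))"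

text \<open>The outcome \<omega> is fixed, so all that follows from the seating rules alone is
  deterministic here and can be interpreted for almost every \<omega>.\<close>

locale valid_path =
  fixes \<theta> :: real and W :: "nat \<Rightarrow> 'a \<Rightarrow> real" and S :: "nat \<Rightarrow> nat \<Rightarrow> 'a \<Rightarrow> nat" and \<omega> :: 'a
  assumes theta_pos: "0 < \<theta>"
    and W_pos: "\<And>i. 1 \<le> i \<Longrightarrow> 0 < W i \<omega>"
    and start: "valid_start S \<omega>"
    and step: "\<And>n. valid_step S n \<omega>"
begin

abbreviation "K n \<equiv> num_tables S n \<omega>"
abbreviation "R n \<equiv> total_rate \<theta> W S n \<omega>"
abbreviation "A n \<equiv> cum_rate \<theta> W S n \<omega>"
abbreviation "Y i n \<equiv> S i n \<omega>"
abbreviation "w i \<equiv> W i \<omega>"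

lemma proper: "proper_seating S n \<omega>"
  by (induction n) (auto intro: proper_seating_0 start proper_seating_Suc step)

lemma
  shows K_pos: "1 \<le> K n" and K_le: "K n \<le> Suc n"
    and Y_nz: "1 \<le> i \<Longrightarrow> Y i n \<noteq> 0 \<longleftrightarrow> i \<le> K n"
    and Y_sum: "(\<Sum>i = 1..K n. Y i n) = Suc n"
  using proper[of n] by (auto simp: proper_seating_def)

lemma Y_sum_real: "(\<Sum>i = 1..K n. real (Y i n)) = real n + 1"
  using Y_sum[of n] by (metis Suc_eq_plus1 of_nat_1 of_nat_add of_nat_sum)

lemma Y_Suc: obtains i where "1 \<le> i" "i \<le> K n + 1" "\<And>j. 1 \<le> j \<Longrightarrow> Y j (Suc n) = Y j n + of_bool (j = i)"
  using step[of n] unfolding valid_step_def seats_at_def by auto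

lemma Y_mono: assumes "1 \<le> j" "m \<le> n" shows "Y j m \<le> Y j n"
proof -
  have "Y j n \<le> Y j (Suc n)" for n
  proof -
    obtain i where "\<And>j. 1 \<le> j \<Longrightarrow> Y j (Suc n) = Y j n + of_bool (j = i)" using Y_Suc by blast
    then show ?thesis using assms(1) by simp
  qed
  then show ?thesis using assms(2) by (rule lift_Suc_mono_le)
qed

lemma Y_le: assumes "1 \<le> i" shows "real (Y i n) \<le> real n + 1"
proof (cases "i \<le> K n")
  case True
  have "Y i n \<le> (\<Sum>i = 1..K n. Y i n)" using assms True by (intro member_le_sum) auto
  then show ?thesis using Y_sum[of n] by simp
next
  case False
  then have "Y i n = 0" using Y_nz[OF assms, of n] by blast
  then show ?thesis by simp
qed

lemma R_ge: "\<theta> \<le> R n"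
  unfolding total_rate_def by (auto intro!: sum_nonneg mult_nonneg_nonneg less_imp_le[OF W_pos])

lemma R_pos: "0 < R n"
  using R_ge[of n] theta_pos by linarith

lemma A_Suc: "A (Suc n) = A n + 1 / R n"
  by (simp add: cum_rate_def)

lemma A_mono: assumes "m \<le> n" shows "A m \<le> A n"
  using assms by (rule lift_Suc_mono_le[rotated]) (simp add: A_Suc R_pos less_imp_le)

lemma A_nonneg: "0 \<le> A n"
  using A_mono[of 0 n] by (simp add: cum_rate_def)

lemma weighted_total: "(\<Sum>i = 1..K n. w i * real (Y i n)) = R n - \<theta>"
  by (simp add: total_rate_def)

text \<open>The inequality 1 + x \<le> exp x, scaled by the rate. It closes the drift estimate of
  all three supermartingales, since \<open>1 / R n\<close> is the increment of the clock.\<close>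

lemma one_plus_le_exp: "R n + b \<le> R n * exp (b * (1 / R n))"
proof -
  have "R n * (1 + b / R n) \<le> R n * exp (b / R n)"
    using R_pos[of n] by (intro mult_left_mono exp_ge_add_one_self) auto
  then show ?thesis using R_pos[of n] by (simp add: distrib_left)
qed

end

text \<open>The properties of almost every path from which the theorem follows deterministically.\<close>

locale crp_path = valid_path +
  fixes s :: ereal
  assumes bdd_tables: "\<And>q::nat. \<And>\<sigma>. \<bar>\<sigma>\<bar> = 1 \<Longrightarrow> \<exists>C. \<forall>n.
      exp (\<sigma> / Suc q * real (num_tables S n \<omega>) - (exp (\<sigma> / Suc q) - 1) * \<theta> * cum_rate \<theta> W S n \<omega>) \<le> C"
    and bdd_table: "\<And>j m l. 1 \<le> j \<Longrightarrow> 1 \<le> m \<Longrightarrow> m \<le> S j l \<omega> \<Longrightarrow> \<exists>C. \<forall>n\<ge>l.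
      exp (real m / Suc m * W j \<omega> * (cum_rate \<theta> W S n \<omega> - cum_rate \<theta> W S l \<omega>)) / real (S j n \<omega>) \<le> C"
    and bdd_light: "\<And>v. v \<in> \<rat> \<Longrightarrow> 0 < v \<Longrightarrow> \<exists>C. \<forall>n.
      (light_customers v W S n \<omega> + \<theta> / v) * exp (- v * cum_rate \<theta> W S n \<omega>) \<le> C"
    and W_less: "\<And>i. 1 \<le> i \<Longrightarrow> ereal (W i \<omega>) < s"
    and W_gr: "\<And>v. v \<in> \<rat> \<Longrightarrow> ereal v < s \<Longrightarrow> \<exists>j\<ge>1. v < W j \<omega>"
begin

section \<open>Number of tables against the clock\<close>

text \<open>The logarithm of \<open>bdd_tables\<close> with \<sigma> = 1. The factor of \<theta> *
  \<open>A n\<close> exceeds one but tends to one as \<open>q\<close> grows. The choice \<sigma> =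
  -1 gives the lower bound in the same way.\<close>

lemma K_upper:
  obtains C where "\<And>n. real (K n) \<le> real (Suc q) * ((exp (1 / Suc q) - 1) * \<theta> * A n + C)"
proof -
  obtain D where D: "\<And>n. exp (1 / Suc q * real (K n) - (exp (1 / Suc q) - 1) * \<theta> * A n) \<le> D"
    using bdd_tables[of 1 q] by auto
  have "0 < D" using D[of 0] by (meson exp_gt_zero less_le_trans)
  then have "1 / Suc q * real (K n) - (exp (1 / Suc q) - 1) * \<theta> * A n \<le> ln D" for n
    using D[of n] by (simp add: ln_ge_iff)
  then have "real (K n) \<le> real (Suc q) * ((exp (1 / Suc q) - 1) * \<theta> * A n + ln D)" for n
    by (simp add: field_simps)
  then show thesis by (rule that)
qed

lemma K_lower:
  obtains C where "\<And>n. real (Suc q) * ((1 - exp (- 1 / Suc q)) * \<theta> * A n - C) \<le> real (K n)"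
proof -
  obtain D where D: "\<And>n. exp (- 1 / Suc q * real (K n) - (exp (- 1 / Suc q) - 1) * \<theta> * A n) \<le> D"
    using bdd_tables[of "- 1" q] by auto
  have "0 < D" using D[of 0] by (meson exp_gt_zero less_le_trans)
  then have *: "- 1 / Suc q * real (K n) - (exp (- 1 / Suc q) - 1) * \<theta> * A n \<le> ln D" for n
    using D[of n] by (simp only: ln_ge_iff)
  have "real (Suc q) * ((1 - exp (- 1 / Suc q)) * \<theta> * A n - ln D) \<le> real (K n)" for n
  proof -
    have "(1 - exp (- 1 / Suc q)) * \<theta> * A n - ln D \<le> real (K n) / real (Suc q)"
      using *[of n] by (simp add: algebra_simps)
    then show ?thesis by (simp add: field_simps del: of_nat_Suc)
  qed
  then show thesis by (rule that)
qed

text \<open>From some time \<open>N\<close> on, each increment \<open>1 / R n\<close> is at least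
  the corresponding harmonic term divided by \<open>u\<close>; the constant
  \<open>harm N / u\<close> accounts for the time before \<open>N\<close>.\<close>

lemma A_lower:
  assumes "0 < u" "eventually (\<lambda>n. R n \<le> u * (real n + 1)) sequentially"
  obtains C where "eventually (\<lambda>n. harm n / u - C \<le> A n) sequentially"
proof -
  obtain N where N: "\<And>n. N \<le> n \<Longrightarrow> R n \<le> u * (real n + 1)"
    using assms(2) by (auto simp: eventually_sequentially)
  have "harm n / u - harm N / u \<le> A n" if "N \<le> n" for n
    using that
  proof (induction n rule: dec_induct)
    case base then show ?case using A_nonneg by simp
  next
    case (step n)
    have "inverse (real (Suc n)) / u = 1 / (u * (real n + 1))" by (simp add: field_simps)
    also have "\<dots> \<le> 1 / R n" using N[of n] step R_pos[of n] by (intro divide_left_mono mult_pos_pos) (use assms(1) in auto)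
    finally show ?case using step by (simp add: A_Suc harm_Suc add_divide_distrib)
  qed
  then show thesis by (intro that[of "harm N / u"]) (auto simp: eventually_sequentially)
qed

lemma A_upper:
  assumes "0 < u" "eventually (\<lambda>n. u * (real n + 1) \<le> R n) sequentially"
  obtains C where "eventually (\<lambda>n. A n \<le> harm n / u + C) sequentially"
proof -
  obtain N where N: "\<And>n. N \<le> n \<Longrightarrow> u * (real n + 1) \<le> R n"
    using assms(2) by (auto simp: eventually_sequentially)
  have "A n \<le> harm n / u + A N" if "N \<le> n" for n
    using that
  proof (induction n rule: dec_induct)
    case base then show ?case using assms(1) by (simp add: harm_nonneg)
  next
    case (step n)
    have "1 / R n \<le> 1 / (u * (real n + 1))" using N[of n] step R_pos[of n] by (intro divide_left_mono mult_pos_pos) (use assms(1) in auto)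
    also have "\<dots> = inverse (real (Suc n)) / u" by (simp add: field_simps)
    finally show ?case using step by (simp add: A_Suc harm_Suc add_divide_distrib)
  qed
  then show thesis by (intro that[of "A N"]) (auto simp: eventually_sequentially)
qed

text \<open>With at most \<open>k\<close> tables the weights in use are bounded, so the rate grows
  at most linearly, the clock diverges like the harmonic series, and \<open>K_lower\<close> with
  \<open>q = 0\<close> forces \<open>K\<close> beyond \<open>k\<close>.\<close>

lemma exists_gr_K: "\<exists>n. k < K n"
proof (rule ccontr)
  assume "\<nexists>n. k < K n"
  then have Kk: "K n \<le> k" for n by (simp add: not_less)
  \<comment> \<open>A crude common bound for the first \<open>k\<close> weights.\<close>
  define c where "c = (\<Sum>i = 1..k. w i)"
  have c: "w i \<le> c" if "i \<in> {1..k}" for i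
    unfolding c_def using that by (intro member_le_sum) (auto intro: less_imp_le[OF W_pos])
  have "R n \<le> (\<theta> + c) * (real n + 1)" for n
  proof -
    have "(\<Sum>i = 1..K n. w i * real (Y i n)) \<le> (\<Sum>i = 1..K n. c * real (Y i n))"
      using Kk[of n] by (intro sum_mono mult_right_mono c) auto
    also have "\<dots> = c * (real n + 1)" unfolding sum_distrib_left[symmetric] Y_sum_real ..
    finally have "R n \<le> \<theta> + c * (real n + 1)" by (simp add: total_rate_def)
    also have "\<dots> \<le> (\<theta> + c) * (real n + 1)" using theta_pos by (simp add: algebra_simps)
    finally show ?thesis .
  qed
  moreover have c0: "0 \<le> c" unfolding c_def by (auto intro!: sum_nonneg less_imp_le[OF W_pos])
  ultimately obtain C where C: "eventually (\<lambda>n. harm n / (\<theta> + c) - C \<le> A n) sequentially"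
    using A_lower[of "\<theta> + c"] theta_pos by auto
  obtain D where D: "\<And>n. real (Suc 0) * ((1 - exp (- 1 / Suc 0)) * \<theta> * A n - D) \<le> real (K n)"
    using K_lower by blast
  define b where "b = (1 - exp (-1)) * \<theta>"
  have b: "0 < b" using theta_pos by (simp add: b_def)
  have "eventually (\<lambda>n. ((real k + D) / b + C) * (\<theta> + c) < harm n) sequentially"
    using harm_at_top by (simp add: filterlim_at_top_dense)
  with C have "eventually (\<lambda>n. False) sequentially"
  proof eventually_elim
    case (elim n)
    have "(real k + D) / b + C < harm n / (\<theta> + c)"
      using elim(2) theta_pos c0 by (simp add: less_divide_eq)
    then have "(real k + D) / b < A n" using elim(1) by linarith
    then have "real k + D < b * A n" using b by (simp add: divide_less_eq mult.commute)
    then show False using D[of n] Kk[of n] by (simp add: b_def)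
  qed
  then show False by simp
qed

text \<open>\<open>K_upper\<close> bounds the number of tables by an affine function of the clock,
  so a bounded clock would contradict \<open>exists_gr_K\<close>; monotonicity turns unboundedness
  into divergence.\<close>

lemma A_at_top: "filterlim A at_top sequentially"
proof -
  obtain C where C: "\<And>n. real (K n) \<le> real (Suc 0) * ((exp (1 / Suc 0) - 1) * \<theta> * A n + C)"
    using K_upper by blast
  define b where "b = (exp 1 - 1) * \<theta>"
  have b: "0 < b" using theta_pos by (simp add: b_def)
  have "\<exists>N. \<forall>n\<ge>N. Z \<le> A n" for Z
  proof -
    obtain n where n: "nat \<lceil>b * Z + C\<rceil> < K n" using exists_gr_K by blast
    then have "b * Z + C < real (K n)" by linarith
    moreover have "real (K n) \<le> b * A n + C" using C[of n] by (simp add: b_def)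
    ultimately have "b * Z < b * A n" by linarith
    then have "Z \<le> A n" using b by simp
    then show ?thesis using A_mono by (meson order_trans)
  qed
  then show ?thesis by (simp add: filterlim_at_top eventually_sequentially)
qed

lemma exists_seated: assumes "1 \<le> k" shows "\<exists>l. 1 \<le> Y k l"
proof -
  obtain l where "k < K l" using exists_gr_K by blast
  then show ?thesis using Y_nz[OF assms, of l] by (metis One_nat_def Suc_leI less_imp_le neq0_conv)
qed

section \<open>Growth of single tables and the negligibility of lighter ones\<close>

text \<open>\<open>bdd_table\<close> solved for \<open>Y j n\<close>, with the dependence on the
  starting time \<open>l\<close> moved into \<open>C\<close>. The growth exponent is as close to
  \<open>w j\<close> as desired if \<open>m\<close> is large.\<close>

lemma table_lower:
  assumes "1 \<le> j" "1 \<le> m" "m \<le> Y j l"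
  obtains C where "0 < C" "\<And>n. l \<le> n \<Longrightarrow> C * exp (real m / Suc m * w j * A n) \<le> real (Y j n)"
proof -
  define a where "a = real m / Suc m * w j"
  obtain D where D: "\<And>n. l \<le> n \<Longrightarrow> exp (a * (A n - A l)) / real (Y j n) \<le> D"
    using bdd_table[OF assms] unfolding a_def by blast
  have pos: "0 < Y j n" if "l \<le> n" for n
    using Y_mono[OF assms(1) that] assms by simp
  have "0 < exp (a * (A l - A l)) / real (Y j l)" using pos[of l] by simp
  then have "0 < D" using D[of l] by linarith
  have "exp (- a * A l) / D * exp (a * A n) \<le> real (Y j n)" if "l \<le> n" for n
  proof -
    have "exp (a * (A n - A l)) \<le> D * real (Y j n)"
      using D[OF that] pos[OF that] by (simp add: divide_le_eq)
    moreover have "exp (a * (A n - A l)) = exp (- a * A l) * exp (a * A n)"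
      by (simp add: exp_add[symmetric] algebra_simps)
    ultimately show ?thesis using \<open>0 < D\<close> by (simp add: field_simps)
  qed
  then show thesis using \<open>0 < D\<close> by (intro that[folded a_def, of "exp (- a * A l) / D"]) auto
qed

text \<open>The exponent \<open>w k / 2\<close> obtained from \<open>m = 1\<close> suffices here,
  since the clock diverges.\<close>

lemma Y_at_top: assumes "1 \<le> k" shows "filterlim (\<lambda>n. Y k n) at_top sequentially"
proof -
  obtain l where "1 \<le> Y k l" using exists_seated[OF assms] by blast
  then obtain C where C: "0 < C" "\<And>n. l \<le> n \<Longrightarrow> C * exp (real 1 / Suc 1 * w k * A n) \<le> real (Y k n)"
    using table_lower[OF assms le_refl] by blast
  have "filterlim (\<lambda>n. C * exp (real 1 / Suc 1 * w k * A n)) at_top sequentially"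
    using C(1) W_pos[OF assms]
    by (intro filterlim_tendsto_pos_mult_at_top[OF tendsto_const]
          filterlim_compose[OF exp_at_top] A_at_top) auto
  then have "filterlim (\<lambda>n. real (Y k n)) at_top sequentially"
    by (rule filterlim_at_top_mono) (use C(2) in \<open>auto simp: eventually_sequentially\<close>)
  then show ?thesis using filterlim_sequentially_iff_filterlim_real by blast
qed

text \<open>The light customers number at most a multiple of \<open>exp (v * A n)\<close>, whereas
  table \<open>j\<close> has at least a multiple of \<open>exp (a * A n)\<close> for some
  \<open>a > v\<close>.\<close>

lemma light_negligible:
  assumes v: "v \<in> \<rat>" "0 < v" "v < w j" and j: "1 \<le> j"
  shows "(\<lambda>n. light_customers v W S n \<omega> / real (Y j n)) \<longlonglongrightarrow> 0"
proof -
  have "(\<lambda>m. real m / Suc m * w j) \<longlonglongrightarrow> 1 * w j"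
    by (intro tendsto_intros LIMSEQ_n_over_Suc_n)
  then have "eventually (\<lambda>m. v < real m / Suc m * w j) sequentially"
    using v by (intro order_tendstoD(1)) auto
  then have "eventually (\<lambda>m. v < real m / Suc m * w j \<and> 1 \<le> m) sequentially"
    using eventually_ge_at_top[of 1] by eventually_elim auto
  then obtain m where m: "v < real m / Suc m * w j" "1 \<le> m"
    by (auto simp: eventually_sequentially)
  define a where "a = real m / Suc m * w j"
  \<comment> \<open>The exponent \<open>a\<close> is available only once table \<open>j\<close>
    holds \<open>m\<close> customers; that this happens is known from
    \<open>Y_at_top\<close>.\<close>
  obtain l where l: "m \<le> Y j l"
    using Y_at_top[OF j] by (auto simp: filterlim_at_top eventually_sequentially)
  obtain C where C: "0 < C" "\<And>n. l \<le> n \<Longrightarrow> C * exp (a * A n) \<le> real (Y j n)"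
    using table_lower[OF j m(2) l] unfolding a_def by blast
  obtain D where D: "\<And>n. (light_customers v W S n \<omega> + \<theta> / v) * exp (- v * A n) \<le> D"
    using bdd_light[OF v(1,2)] by blast
  have L0: "0 \<le> light_customers v W S n \<omega>" for n
    unfolding light_customers_def by (intro sum_nonneg) auto
  have "light_customers v W S n \<omega> / real (Y j n) \<le> D / C * exp (- (a - v) * A n)" if "l \<le> n" for n
  proof -
    have "light_customers v W S n \<omega> * exp (- v * A n) \<le> D"
      using D[of n] theta_pos v(2) by (smt (verit) divide_pos_pos exp_gt_zero mult_right_mono)
    then have "light_customers v W S n \<omega> \<le> D * exp (v * A n)"
      by (simp add: exp_minus field_simps)
    moreover have "0 < C * exp (a * A n)" using C(1) by simp
    ultimately have "light_customers v W S n \<omega> / real (Y j n) \<le> D * exp (v * A n) / (C * exp (a * A n))"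
      using C(2)[OF that] L0 by (intro frac_le) (auto intro: order_trans[OF L0])
    also have "\<dots> = D / C * exp (- (a - v) * A n)"
      by (simp add: exp_diff algebra_simps)
    finally show ?thesis .
  qed
  moreover have "(\<lambda>n. D / C * exp (- (a - v) * A n)) \<longlonglongrightarrow> D / C * 0"
    using m(1) unfolding a_def[symmetric]
    by (intro tendsto_mult tendsto_const filterlim_compose[OF exp_at_bot]
        filterlim_tendsto_neg_mult_at_bot[OF tendsto_const] A_at_top) auto
  ultimately have "eventually (\<lambda>n. light_customers v W S n \<omega> / real (Y j n) \<le> D / C * exp (- (a - v) * A n)) sequentially"
    "(\<lambda>n. D / C * exp (- (a - v) * A n)) \<longlonglongrightarrow> 0"
    unfolding eventually_sequentially by auto
  then show ?thesis
    by (rule tendsto_sandwich[OF _ _ tendsto_const, rotated]) (intro always_eventually allI divide_nonneg_nonneg L0 of_nat_0_le_iff)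
qed

text \<open>As \<open>w k\<close> lies strictly below \<open>s\<close>, a rational \<open>v\<close>
  fits between them and some table \<open>j\<close> has weight above \<open>v\<close>. Table
  \<open>k\<close> is then among the light tables for \<open>v\<close>.\<close>

lemma exists_heavier:
  assumes "1 \<le> k" obtains j where "1 \<le> j" "(\<lambda>n. real (Y k n) / real (Y j n)) \<longlonglongrightarrow> 0"
proof -
  obtain v where "ereal (w k) < ereal v" "ereal v < s" "v \<in> \<rat>"
  proof -
    obtain r where r: "w k < r" "ereal r < s"
      using ereal_dense2[OF W_less[OF assms]] by auto
    obtain q where "q \<in> \<rat>" "w k < q" "q < r" using Rats_dense_in_real[OF r(1)] by blast
    then show thesis using r(2) by (intro that[of q]) (auto intro: less_trans[of _ "ereal r"])
  qed
  then have v: "w k < v" "ereal v < s" "v \<in> \<rat>" by auto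
  then obtain j where j: "1 \<le> j" "v < w j" using W_gr by blast
  have v0: "0 < v" using W_pos[OF assms] v by simp
  have le: "real (Y k n) \<le> light_customers v W S n \<omega>" for n
  proof (cases "k \<le> K n")
    case True
    have "of_bool (w k < v) * real (Y k n) \<le> light_customers v W S n \<omega>"
      unfolding light_customers_def using True assms
      by (intro member_le_sum[where f = "\<lambda>i. of_bool (w i < v) * real (Y i n)"]) auto
    then show ?thesis using v by simp
  next
    case False then show ?thesis using Y_nz[OF assms, of n]
      by (simp add: light_customers_def sum_nonneg)
  qed
  have "(\<lambda>n. real (Y k n) / real (Y j n)) \<longlonglongrightarrow> 0"
    by (rule tendsto_sandwich[OF _ _ tendsto_const light_negligible[OF v(3) v0 j(2,1)]])
      (auto intro!: always_eventually divide_right_mono le)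
  then show thesis using j that by blast
qed

text \<open>Table \<open>j\<close> from \<open>exists_heavier\<close> has at most
  \<open>n + 1\<close> \<le> \<open>2 * n\<close> customers, so replacing it by \<open>n\<close>
  costs at most a factor of two.\<close>

lemma proportion_vanishes: assumes "1 \<le> k" shows "(\<lambda>n. real (Y k n) / real n) \<longlonglongrightarrow> 0"
proof -
  obtain j where j: "1 \<le> j" "(\<lambda>n. real (Y k n) / real (Y j n)) \<longlonglongrightarrow> 0"
    using exists_heavier[OF assms] .
  have "eventually (\<lambda>n. real (Y k n) / real n \<le> 2 * (real (Y k n) / real (Y j n))) sequentially"
    using Y_at_top[OF j(1), unfolded filterlim_at_top, rule_format, of 1] eventually_ge_at_top[of 1]
  proof eventually_elim
    case (elim n)
    then have "real (Y j n) \<le> 2 * real n" using Y_le[OF j(1), of n] by simp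
    then have "real (Y k n) / (2 * real n) \<le> real (Y k n) / real (Y j n)"
      using elim by (intro divide_left_mono) auto
    then show ?case by simp
  qed
  then show ?thesis
    by (rule tendsto_sandwich[OF _ _ tendsto_const tendsto_mult_right_zero[OF j(2)], rotated]) simp
qed

section \<open>The leading table\<close>

lemma eventually_not_most_occupied:
  assumes "1 \<le> k" shows "eventually (\<lambda>n. \<not> most_occupied S n \<omega> k) sequentially"
proof -
  obtain j where j: "1 \<le> j" "(\<lambda>n. real (Y k n) / real (Y j n)) \<longlonglongrightarrow> 0"
    using exists_heavier[OF assms] .
  have "eventually (\<lambda>n. real (Y k n) / real (Y j n) < 1) sequentially"
    using j(2) by (rule order_tendstoD) simp
  \<comment> \<open>The quotient is below one also when \<open>Y j n = 0\<close>, because division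
    by zero gives zero; hence the positivity of \<open>Y j n\<close> is supplied as well.\<close>
  then show ?thesis using Y_at_top[OF j(1), unfolded filterlim_at_top, rule_format, of 1]
  proof eventually_elim
    case (elim n)
    then have "Y k n < Y j n" by (simp add: divide_less_eq)
    then show ?case using j(1) by (auto simp: most_occupied_def not_le)
  qed
qed

text \<open>Only the finitely many tables up to \<open>K m\<close> are occupied at time
  \<open>m\<close>, and each of them eventually ceases to lead. From then on the leader is a table
  that was still empty at time \<open>m\<close>.\<close>

lemma first_occupancy_at_top:
  assumes T: "\<And>n. most_occupied S n \<omega> (T n)"
  shows "filterlim (\<lambda>n. first_occupancy S (T n) \<omega>) at_top sequentially"
  unfolding filterlim_at_top
proof
  fix m
  have "eventually (\<lambda>n. \<forall>k\<in>{1..K m}. \<not> most_occupied S n \<omega> k) sequentially"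
    by (intro eventually_ball_finite) (auto intro: eventually_not_most_occupied)
  then show "eventually (\<lambda>n. m \<le> first_occupancy S (T n) \<omega>) sequentially"
  proof eventually_elim
    case (elim n)
    have T1: "1 \<le> T n" using T[of n] by (simp add: most_occupied_def)
    then have "\<not> T n \<le> K m" using elim T[of n] by auto
    then have Z: "Y (T n) m = 0" using Y_nz[OF T1] by blast
    obtain l where "1 \<le> Y (T n) l" using exists_seated[OF T1] by blast
    then have "1 \<le> Y (T n) (first_occupancy S (T n) \<omega>)"
      unfolding first_occupancy_def by (rule LeastI)
    then show ?case using Y_mono[OF T1, of "first_occupancy S (T n) \<omega>" m] Z by (cases "m \<le> first_occupancy S (T n) \<omega>") auto
  qed
qed

lemma exists_most_occupied: "\<exists>i. most_occupied S n \<omega> i"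
proof -
  have "Max ((\<lambda>i. Y i n) ` {1..K n}) \<in> (\<lambda>i. Y i n) ` {1..K n}"
    using K_pos[of n] by (intro Max_in) auto
  then obtain i where i: "i \<in> {1..K n}" "Y i n = Max ((\<lambda>i. Y i n) ` {1..K n})" by auto
  have "Y j n \<le> Y i n" if "1 \<le> j" for j
    using Y_nz[OF that, of n] i(2) that by (cases "j \<le> K n") (auto intro!: Max_ge)
  then show ?thesis using i(1) unfolding most_occupied_def by auto
qed

text \<open>Only the tables up to \<open>K n\<close> are nonempty, so the infinite family of
  proportions has finitely many values and its \<open>Max\<close> is a genuine maximum.\<close>

lemma max_proportion:
  assumes "most_occupied S n \<omega> i"
  shows "Max ((\<lambda>i. real (Y i n) / real n) ` {1..}) = real (Y i n) / real n"
proof (rule Max_eqI)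
  have "(\<lambda>i. real (Y i n) / real n) ` {1..} \<subseteq> insert 0 ((\<lambda>i. real (Y i n) / real n) ` {1..K n})"
  proof
    fix x assume "x \<in> (\<lambda>i. real (Y i n) / real n) ` {1..}"
    then obtain j where j: "1 \<le> j" "x = real (Y j n) / real n" by auto
    show "x \<in> insert 0 ((\<lambda>i. real (Y i n) / real n) ` {1..K n})"
      using j Y_nz[OF j(1), of n] by (cases "j \<le> K n") auto
  qed
  then show "finite ((\<lambda>i. real (Y i n) / real n) ` {1..})"
    by (rule finite_subset) auto
qed (use assms in \<open>auto simp: most_occupied_def intro!: divide_right_mono\<close>)

text \<open>A single arrival makes \<open>j\<close> catch up with \<open>i\<close>, so beforehand
  \<open>j\<close> has at most one customer less; together the two tables hold at most
  \<open>n + 1\<close> customers.\<close>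

lemma change_of_leader:
  assumes "most_occupied S n \<omega> i" "most_occupied S (Suc n) \<omega> j" "i \<noteq> j"
  shows "2 * real (Y i n) \<le> real n + 2"
proof -
  have ij: "1 \<le> i" "1 \<le> j" using assms by (auto simp: most_occupied_def)
  obtain k where k: "\<And>j. 1 \<le> j \<Longrightarrow> Y j (Suc n) = Y j n + of_bool (j = k)" using Y_Suc by blast
  have "Y i (Suc n) \<le> Y j (Suc n)" using assms(2) ij by (auto simp: most_occupied_def)
  then have le: "Y i n \<le> Y j n + 1" using k[OF ij(1)] k[OF ij(2)] by (auto simp: of_bool_def split: if_splits)
  have "Y i n + Y j n \<le> Suc n"
  proof (cases "i \<le> K n \<and> j \<le> K n")
    case True
    have "Y i n + Y j n = (\<Sum>k\<in>{i, j}. Y k n)" using assms(3) by simp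
    also have "\<dots> \<le> (\<Sum>k = 1..K n. Y k n)" using True ij by (intro sum_mono2) auto
    finally show ?thesis using Y_sum[of n] by simp
  next
    case False
    then have "Y i n = 0 \<or> Y j n = 0" using Y_nz ij by blast
    then show ?thesis using Y_le[OF ij(1), of n] Y_le[OF ij(2), of n] by (auto; linarith)
  qed
  then show ?thesis using le by linarith
qed

lemma max_proportion_not_to_1: "\<not> (\<lambda>n. Max ((\<lambda>i. real (Y i n) / real n) ` {1..})) \<longlonglongrightarrow> 1"
proof
  assume "(\<lambda>n. Max ((\<lambda>i. real (Y i n) / real n) ` {1..})) \<longlonglongrightarrow> 1"
  then have "eventually (\<lambda>n. 3 / 4 < Max ((\<lambda>i. real (Y i n) / real n) ` {1..})) sequentially"
    by (rule order_tendstoD) simp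
  then obtain N where N: "\<And>n. N \<le> n \<Longrightarrow> 3 / 4 < Max ((\<lambda>i. real (Y i n) / real n) ` {1..})"
    by (auto simp: eventually_sequentially)
  define T where "T n = (SOME i. most_occupied S n \<omega> i)" for n
  have T: "most_occupied S n \<omega> (T n)" for n
    unfolding T_def using exists_most_occupied by (rule someI_ex)
  \<comment> \<open>\<open>3 / 4 * n < Y\<close> and \<open>2 * Y \<le> n + 2\<close> together force
    \<open>n < 4\<close>, so from time 5 on the leader could not change.\<close>
  let ?N = "max N 5"
  have same: "T (Suc n) = T n" if "?N \<le> n" for n
  proof (rule ccontr)
    assume "T (Suc n) \<noteq> T n"
    then have "2 * real (Y (T n) n) \<le> real n + 2" using change_of_leader[OF T T] by metis
    moreover have "3 / 4 < real (Y (T n) n) / real n"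
      using N[of n] that max_proportion[OF T, of n] by simp
    ultimately show False using that by (simp add: less_divide_eq)
  qed
  have "T n = T ?N" if "?N \<le> n" for n
    using that by (induction n rule: dec_induct) (use same in auto)
  then have "eventually (\<lambda>n. most_occupied S n \<omega> (T ?N)) sequentially"
    using T unfolding eventually_sequentially by metis
  moreover have "eventually (\<lambda>n. \<not> most_occupied S n \<omega> (T ?N)) sequentially"
    using T[of ?N] by (intro eventually_not_most_occupied) (simp add: most_occupied_def)
  ultimately have "eventually (\<lambda>n. False) sequentially" by eventually_elim auto
  then show False by simp
qed

section \<open>Growth of the total rate and of the number of tables\<close>

text \<open>For a rational \<open>q\<close> between \<open>v\<close> and \<open>s\<close>, nearly
  all customers eventually sit at tables of weight at least \<open>q\<close>.\<close>

lemma R_lower: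
  assumes "0 < v" "ereal v < s"
  shows "eventually (\<lambda>n. v * (real n + 1) \<le> R n) sequentially"
proof -
  obtain r where r: "v < r" "ereal r < s" using ereal_dense2[OF assms(2)] by auto
  obtain q where q: "q \<in> \<rat>" "v < q" "q < r" using Rats_dense_in_real[OF r(1)] by blast
  have "ereal q < s" using q(3) r(2) by (auto intro: less_trans[of _ "ereal r"])
  then obtain j where j: "1 \<le> j" "q < w j" using W_gr q(1) by blast
  have q0: "0 < q" using assms q by simp
  \<comment> \<open>A light proportion of at most \<open>1 - v / q\<close> leaves a proportion
    \<open>v / q\<close> of customers with weight at least \<open>q\<close>, which contribute rate
    \<open>v\<close> per customer overall.\<close>
  have "eventually (\<lambda>n. light_customers q W S n \<omega> / real (Y j n) < 1 - v / q) sequentially"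
    using light_negligible[OF q(1) q0 j(2,1)] by (rule order_tendstoD) (use assms q in simp)
  then show ?thesis using Y_at_top[OF j(1), unfolded filterlim_at_top, rule_format, of 1]
  proof eventually_elim
    case (elim n)
    have "light_customers q W S n \<omega> \<le> (1 - v / q) * real (Y j n)"
      using elim by (simp add: divide_less_eq)
    also have "\<dots> \<le> (1 - v / q) * (real n + 1)"
      using Y_le[OF j(1), of n] assms q q0 by (intro mult_left_mono) auto
    finally have L: "q * light_customers q W S n \<omega> \<le> (q - v) * (real n + 1)"
      using q0 by (simp add: field_simps)
    have "q * (real n + 1) - q * light_customers q W S n \<omega> =
      (\<Sum>i = 1..K n. q * (1 - of_bool (w i < q)) * real (Y i n))"
      unfolding light_customers_def Y_sum_real[symmetric] sum_distrib_left sum_subtractf[symmetric]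
      by (intro sum.cong refl) (simp add: algebra_simps)
    also have "\<dots> \<le> (\<Sum>i = 1..K n. w i * real (Y i n))"
      by (intro sum_mono mult_right_mono) (auto intro: less_imp_le[OF W_pos])
    also have "\<dots> \<le> R n" using theta_pos by (simp add: total_rate_def)
    finally show ?case using L by (simp add: algebra_simps)
  qed
qed

text \<open>All weights are at most \<open>r\<close>; the slack \<open>u - r\<close> absorbs the
  additive \<theta> once \<open>n\<close> is at least \<theta> / (u - r).\<close>

lemma R_upper:
  assumes "s \<le> ereal r" "r < u"
  shows "eventually (\<lambda>n. R n \<le> u * (real n + 1)) sequentially"
proof -
  have "R n \<le> \<theta> + r * (real n + 1)" for n
  proof -
    have "w i \<le> r" if "1 \<le> i" for i
      using less_le_trans[OF W_less[OF that] assms(1)] by simp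
    then have "(\<Sum>i = 1..K n. w i * real (Y i n)) \<le> (\<Sum>i = 1..K n. r * real (Y i n))"
      by (intro sum_mono mult_right_mono) auto
    then show ?thesis unfolding total_rate_def sum_distrib_left[symmetric] Y_sum_real by simp
  qed
  moreover have "eventually (\<lambda>n. \<theta> / (u - r) \<le> real n) sequentially"
    using filterlim_real_sequentially by (simp add: filterlim_at_top)
  then have "eventually (\<lambda>n. \<theta> + r * (real n + 1) \<le> u * (real n + 1)) sequentially"
  proof eventually_elim
    case (elim n)
    then have "\<theta> \<le> (u - r) * real n" using assms(2) by (simp add: divide_le_eq mult.commute)
    also have "\<dots> \<le> (u - r) * (real n + 1)" using assms(2) by (intro mult_left_mono) auto
    finally show ?case by (simp add: algebra_simps)
  qed
  ultimately show ?thesis by (auto elim!: eventually_mono intro: order_trans)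
qed

text \<open>The chain is \<open>R_lower\<close>, then \<open>A_upper\<close>, then
  \<open>K_upper\<close>: the number of tables is at most \<open>b / v * harm n\<close> plus a
  constant, and \<open>q\<close> is taken so large that \<open>b / v < a\<close>.\<close>

lemma K_growth_upper:
  assumes "0 < v" "ereal v < s" "\<theta> / v < a"
  shows "eventually (\<lambda>n. real (K n) / ln (real n) < a) sequentially"
proof -
  have "(\<lambda>q. real (Suc q) * ((exp (1 / Suc q) - 1) / 1) * (\<theta> / v)) \<longlonglongrightarrow> 1 * (\<theta> / v)"
    by (intro tendsto_mult exp_difference_quotient tendsto_const) simp
  then have "eventually (\<lambda>q. real (Suc q) * ((exp (1 / Suc q) - 1) / 1) * (\<theta> / v) < a) sequentially"
    using assms by (intro order_tendstoD(2)) auto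
  then obtain q where q: "real (Suc q) * (exp (1 / Suc q) - 1) * (\<theta> / v) < a"
    by (auto simp: eventually_sequentially)
  define b where "b = real (Suc q) * (exp (1 / Suc q) - 1) * \<theta>"
  have b: "0 \<le> b" using theta_pos by (simp add: b_def)
  obtain C where C: "\<And>n. real (K n) \<le> real (Suc q) * ((exp (1 / Suc q) - 1) * \<theta> * A n + C)"
    using K_upper by blast
  obtain D where D: "eventually (\<lambda>n. A n \<le> harm n / v + D) sequentially"
    using A_upper[OF assms(1) R_lower[OF assms(1,2)]] by blast
  have "eventually (\<lambda>n. (b / v * harm n + (b * D + real (Suc q) * C)) / ln (real n) < a) sequentially"
    using affine_harm_over_ln by (rule order_tendstoD) (use q in \<open>simp add: b_def\<close>)
  then show ?thesis using D eventually_gt_at_top[of 1]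
  proof eventually_elim
    case (elim n)
    have "real (K n) \<le> b * A n + real (Suc q) * C" using C[of n] by (simp add: b_def algebra_simps)
    also have "\<dots> \<le> b * (harm n / v + D) + real (Suc q) * C"
      using elim b by (intro add_right_mono mult_left_mono) auto
    finally have "real (K n) \<le> b / v * harm n + (b * D + real (Suc q) * C)" by (simp add: algebra_simps)
    then have "real (K n) / ln (real n) \<le> (b / v * harm n + (b * D + real (Suc q) * C)) / ln (real n)"
      using elim by (intro divide_right_mono) auto
    then show ?case using elim by linarith
  qed
qed

lemma K_growth_lower:
  assumes "s \<le> ereal r" "0 < r" "a < \<theta> / r"
  shows "eventually (\<lambda>n. a < real (K n) / ln (real n)) sequentially"
proof -
  have "((\<lambda>u. \<theta> / u) \<longlongrightarrow> \<theta> / r) (at_right r)"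
    using assms(2) by (intro tendsto_intros) auto
  then have "eventually (\<lambda>u. a < \<theta> / u) (at_right r)" using assms(3) by (rule order_tendstoD)
  \<comment> \<open>A value \<open>u\<close> slightly above \<open>r\<close> is needed because the
    rate also contains \<theta>; continuity keeps \<theta> / u above \<open>a\<close>.\<close>
  then obtain u where u: "r < u" "a < \<theta> / u"
    using eventually_happens'[OF trivial_limit_at_right_real eventually_conj[OF eventually_at_right_less]] by blast
  have "(\<lambda>q. real (Suc q) * ((exp (- 1 / Suc q) - 1) / - 1) * (\<theta> / u)) \<longlonglongrightarrow> 1 * (\<theta> / u)"
    by (intro tendsto_mult exp_difference_quotient tendsto_const) simp
  then have "eventually (\<lambda>q. a < real (Suc q) * ((exp (- 1 / Suc q) - 1) / - 1) * (\<theta> / u)) sequentially"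
    using u by (intro order_tendstoD(1)) auto
  then obtain q where q: "a < real (Suc q) * (1 - exp (- 1 / Suc q)) * (\<theta> / u)"
    by (auto simp: eventually_sequentially)
  define b where "b = real (Suc q) * (1 - exp (- 1 / Suc q)) * \<theta>"
  have b: "0 \<le> b" using theta_pos by (simp add: b_def)
  obtain C where C: "\<And>n. real (Suc q) * ((1 - exp (- 1 / Suc q)) * \<theta> * A n - C) \<le> real (K n)"
    using K_lower by blast
  obtain D where D: "eventually (\<lambda>n. harm n / u - D \<le> A n) sequentially"
    using A_lower[OF _ R_upper[OF assms(1) u(1)]] assms u by auto
  have "eventually (\<lambda>n. a < (b / u * harm n + - (b * D + real (Suc q) * C)) / ln (real n)) sequentially"
    using affine_harm_over_ln by (rule order_tendstoD) (use q in \<open>simp add: b_def\<close>)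
  then show ?thesis using D eventually_gt_at_top[of 1]
  proof eventually_elim
    case (elim n)
    have "b * (harm n / u - D) - real (Suc q) * C \<le> b * A n - real (Suc q) * C"
      using elim b by (intro diff_right_mono mult_left_mono) auto
    also have "\<dots> \<le> real (K n)" using C[of n] by (simp add: b_def algebra_simps)
    finally have "b / u * harm n + - (b * D + real (Suc q) * C) \<le> real (K n)" by (simp add: algebra_simps)
    then have "(b / u * harm n + - (b * D + real (Suc q) * C)) / ln (real n) \<le> real (K n) / ln (real n)"
      using elim by (intro divide_right_mono) auto
    then show ?case using elim by linarith
  qed
qed

lemma s_pos: "0 < s"
  using W_pos[of 1] W_less[of 1] by (metis ereal_less(2) le_refl less_trans)

lemma K_growth: "(\<lambda>n. ereal (real (K n) / ln (real n))) \<longlonglongrightarrow> ereal \<theta> / s"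
proof (cases s)
  case (real r)
  then have r: "0 < r" using s_pos by simp
  have "(\<lambda>n. real (K n) / ln (real n)) \<longlonglongrightarrow> \<theta> / r"
  proof (rule order_tendstoI)
    fix a assume "a < \<theta> / r"
    then show "eventually (\<lambda>n. a < real (K n) / ln (real n)) sequentially"
      using K_growth_lower[of r a] real r by simp
  next
    fix a assume a: "\<theta> / r < a"
    have "((\<lambda>u. \<theta> / u) \<longlongrightarrow> \<theta> / r) (at_left r)" using r by (intro tendsto_intros) auto
    then have "eventually (\<lambda>u. \<theta> / u < a) (at_left r)" using a by (rule order_tendstoD)
    moreover have "eventually (\<lambda>u. u \<in> {0<..<r}) (at_left r)" using r by (intro eventually_at_leftI[of 0]) auto
    ultimately have "eventually (\<lambda>u. \<theta> / u < a \<and> u \<in> {0<..<r}) (at_left r)" by eventually_elim auto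
    then obtain v where "\<theta> / v < a" "0 < v" "v < r"
      using eventually_happens'[OF trivial_limit_at_left_real] by fastforce
    then show "eventually (\<lambda>n. real (K n) / ln (real n) < a) sequentially"
      using K_growth_upper[of v a] real by simp
  qed
  then show ?thesis using real r by simp
next
  case PInf
  have "(\<lambda>n. real (K n) / ln (real n)) \<longlonglongrightarrow> 0"
  proof (rule order_tendstoI)
    fix a :: real assume "a < 0"
    show "eventually (\<lambda>n. a < real (K n) / ln (real n)) sequentially"
      using eventually_gt_at_top[of 1]
    proof eventually_elim
      case (elim n)
      then have "0 \<le> real (K n) / ln (real n)" by simp
      then show ?case using \<open>a < 0\<close> by linarith
    qed
  next
    fix a :: real assume a: "0 < a"
    show "eventually (\<lambda>n. real (K n) / ln (real n) < a) sequentially"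
      \<comment> \<open>With \<open>v = 2 * \<theta> / a\<close> the quotient \<theta> / v is
        \<open>a / 2\<close>, and every real \<open>v\<close> lies below the infinite
        supremum.\<close>
      using a theta_pos PInf by (intro K_growth_upper[of "2 * \<theta> / a"]) auto
  qed
  then show ?thesis using PInf by (simp add: zero_ereal_def)
qed (use s_pos in auto)

end

section \<open>Supermartingales of the restaurant process\<close>

lemma pred_eq_plus:
  fixes f g :: "'a \<Rightarrow> nat"
  assumes f: "f \<in> measurable M (count_space UNIV)" and g: "g \<in> measurable M (count_space UNIV)"
  shows "Measurable.pred M (\<lambda>\<omega>. f \<omega> = g \<omega> + c)"
proof (rule measurable_compose_countable[OF _ g])
  show "Measurable.pred M (\<lambda>\<omega>. f \<omega> = k + c)" for k
    using measurable_compose[OF f, of "\<lambda>x. x = k + c"] by simp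
qed

lemma num_tables_measurable:
  assumes "\<And>i. 1 \<le> i \<Longrightarrow> S i n \<in> measurable N (count_space UNIV)"
  shows "num_tables S n \<in> measurable N (count_space UNIV)"
proof -
  have "Measurable.pred N (\<lambda>\<omega>. 1 \<le> i \<and> S i n \<omega> \<noteq> 0)" for i
  proof (cases "1 \<le> i")
    case True
    note [measurable] = assms[OF True]
    show ?thesis by measurable
  qed simp
  then have "(\<lambda>\<omega>. Max {i. 1 \<le> i \<and> S i n \<omega> \<noteq> 0}) \<in> measurable N (count_space UNIV)"
    by (rule measurable_Max_nat[where P = "\<lambda>i \<omega>. 1 \<le> i \<and> S i n \<omega> \<noteq> 0"])
  then show ?thesis unfolding num_tables_def[abs_def] .
qed

text \<open>The number of summands is random but takes countably many values, so it suffices to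
  treat each fixed number \<open>k\<close>.\<close>

lemma table_sum_measurable:
  fixes g :: "nat \<Rightarrow> 'a \<Rightarrow> real"
  assumes "\<And>i. 1 \<le> i \<Longrightarrow> S i n \<in> measurable N (count_space UNIV)"
    and "\<And>i. 1 \<le> i \<Longrightarrow> g i \<in> borel_measurable N"
  shows "(\<lambda>\<omega>. \<Sum>i = 1..num_tables S n \<omega>. g i \<omega>) \<in> borel_measurable N"
proof (rule measurable_compose_countable[OF _ num_tables_measurable])
  show "(\<lambda>\<omega>. \<Sum>i = 1..k. g i \<omega>) \<in> borel_measurable N" for k
    by (intro borel_measurable_sum assms(2)) auto
qed (use assms(1) in auto)

lemma weighted_sum_measurable:
  fixes g :: "nat \<Rightarrow> 'a \<Rightarrow> real"
  assumes "\<And>i. 1 \<le> i \<Longrightarrow> S i n \<in> measurable N (count_space UNIV)"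
    and "\<And>i. 1 \<le> i \<Longrightarrow> g i \<in> borel_measurable N"
  shows "(\<lambda>\<omega>. \<Sum>i = 1..num_tables S n \<omega>. g i \<omega> * real (S i n \<omega>)) \<in> borel_measurable N"
proof (rule table_sum_measurable)
  fix i :: nat assume i: "1 \<le> i"
  note [measurable] = assms[OF i]
  show "(\<lambda>\<omega>. g i \<omega> * real (S i n \<omega>)) \<in> borel_measurable N" by measurable
qed (use assms(1) in auto)

lemma total_rate_measurable:
  assumes "\<And>i. 1 \<le> i \<Longrightarrow> S i n \<in> measurable N (count_space UNIV)"
    and "\<And>i. 1 \<le> i \<Longrightarrow> W i \<in> borel_measurable N"
  shows "total_rate \<theta> W S n \<in> borel_measurable N"
  unfolding total_rate_def[abs_def]
  by (intro borel_measurable_add borel_measurable_const weighted_sum_measurable) (use assms in auto)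

lemma cum_rate_measurable:
  assumes "\<And>i m. 1 \<le> i \<Longrightarrow> m \<le> n \<Longrightarrow> S i m \<in> measurable N (count_space UNIV)"
    and "\<And>i. 1 \<le> i \<Longrightarrow> W i \<in> borel_measurable N"
  shows "cum_rate \<theta> W S n \<in> borel_measurable N"
  unfolding cum_rate_def[abs_def]
  by (intro borel_measurable_sum borel_measurable_divide borel_measurable_const total_rate_measurable)
    (use assms in auto)

lemma light_customers_measurable:
  assumes "\<And>i. 1 \<le> i \<Longrightarrow> S i n \<in> measurable N (count_space UNIV)"
    and "\<And>i. 1 \<le> i \<Longrightarrow> W i \<in> borel_measurable N"
  shows "light_customers v W S n \<in> borel_measurable N"
  unfolding light_customers_def[abs_def]
proof (intro weighted_sum_measurable assms)
  fix i :: nat assume i: "1 \<le> i"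
  note [measurable] = assms(2)[OF i]
  show "(\<lambda>\<omega>. of_bool (W i \<omega> < v) :: real) \<in> borel_measurable N" by measurable
qed

locale positive_CRP = disordered_CRP +
  assumes theta_pos: "0 < \<theta>"
    and weight_law: "real_distribution \<mu>"
    and weight_pos: "AE w in \<mu>. 0 < w"
    and no_atom: "measure \<mu> {w. ereal w = esssup \<mu> ereal} = 0"
begin

abbreviation "F \<equiv> history M W S"
abbreviation "tables \<equiv> num_tables S"
abbreviation "rate \<equiv> total_rate \<theta> W S"
abbreviation "clock \<equiv> cum_rate \<theta> W S"

lemma W_measurable: assumes "1 \<le> i" shows "W i \<in> borel_measurable M"
  using weights_indep assms by (auto simp: indep_vars_def)

lemma history_generator_subset:
  "((\<Union>i\<in>{1..}. sets (vimage_algebra (space M) (W i) borel)) \<union>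
    (\<Union>i\<in>{1..}. \<Union>m\<in>{..n}. sets (vimage_algebra (space M) (S i m) (count_space UNIV)))) \<subseteq> sets M"
proof -
  have "sets (vimage_algebra (space M) (W i) borel) \<subseteq> sets M" if "1 \<le> i" for i
    using W_measurable[OF that] by (simp add: measurable_iff_sets)
  moreover have "sets (vimage_algebra (space M) (S i m) (count_space UNIV)) \<subseteq> sets M" if "1 \<le> i" for i m
    using S_measurable[OF that, of m] by (simp add: measurable_iff_sets)
  ultimately show ?thesis by (intro Un_least UN_least) simp_all
qed

lemma sets_history: "sets (F n) = sigma_sets (space M)
     ((\<Union>i\<in>{1..}. sets (vimage_algebra (space M) (W i) borel)) \<union>
      (\<Union>i\<in>{1..}. \<Union>m\<in>{..n}. sets (vimage_algebra (space M) (S i m) (count_space UNIV))))"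
  unfolding history_def
  by (rule sets_measure_of) (use history_generator_subset sets.sets_into_space in blast)

lemma space_history: "space (F n) = space M"
  unfolding history_def
  by (rule space_measure_of) (use history_generator_subset sets.sets_into_space in blast)

lemma history_subalgebra: "subalgebra M (F n)"
  unfolding subalgebra_def space_history sets_history
  using sets.sigma_sets_subset[OF history_generator_subset] by simp

lemma history_mono: "sets (F n) \<subseteq> sets (F (Suc n))"
  unfolding sets_history by (intro sigma_sets_mono') (auto simp: le_SucI; metis le_SucI)

lemma W_history: assumes "1 \<le> i" shows "W i \<in> borel_measurable (F n)"
proof (rule measurableI)
  fix B :: "real set" assume "B \<in> sets borel"
  then have "W i -` B \<inter> space M \<in> sets (vimage_algebra (space M) (W i) borel)"
    by (rule in_vimage_algebra)
  then show "W i -` B \<inter> space (F n) \<in> sets (F n)"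
    unfolding space_history sets_history using assms by (intro sigma_sets.Basic) auto
qed simp

lemma S_history: assumes "1 \<le> i" "m \<le> n" shows "S i m \<in> measurable (F n) (count_space UNIV)"
proof (rule measurableI)
  fix B :: "nat set" assume "B \<in> sets (count_space UNIV)"
  then have "S i m -` B \<inter> space M \<in> sets (vimage_algebra (space M) (S i m) (count_space UNIV))"
    by (rule in_vimage_algebra)
  then show "S i m -` B \<inter> space (F n) \<in> sets (F n)"
    unfolding space_history sets_history using assms by (intro sigma_sets.Basic) auto
qed simp

lemma K_history: "m \<le> n \<Longrightarrow> tables m \<in> measurable (F n) (count_space UNIV)"
  by (intro num_tables_measurable S_history) auto

lemma R_history: "m \<le> n \<Longrightarrow> rate m \<in> borel_measurable (F n)"
  by (intro total_rate_measurable S_history W_history) auto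

lemma A_history: "m \<le> n \<Longrightarrow> clock m \<in> borel_measurable (F n)"
  by (intro cum_rate_measurable S_history W_history) auto

lemma light_history: "m \<le> n \<Longrightarrow> light_customers v W S m \<in> borel_measurable (F n)"
  by (intro light_customers_measurable S_history W_history) auto

lemma K_measurable [measurable]: "tables n \<in> measurable M (count_space UNIV)"
  by (intro num_tables_measurable S_measurable) auto

lemma joins_table_eq: assumes "1 \<le> i" shows "joins_table M S n i = {\<omega> \<in> space M. seats_at S n i \<omega>}"
  unfolding joins_table_def seats_at_def using assms by auto

lemma seats_at_measurable: assumes "1 \<le> i" shows "{\<omega> \<in> space M. seats_at S n i \<omega>} \<in> sets M"
proof -
  have "Measurable.pred M (\<lambda>\<omega>. 1 \<le> j \<longrightarrow> S j (Suc n) \<omega> = S j n \<omega> + of_bool (j = i))" for j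
  proof (cases "1 \<le> j")
    case True
    then have eq: "(\<lambda>\<omega>. 1 \<le> j \<longrightarrow> S j (Suc n) \<omega> = S j n \<omega> + of_bool (j = i)) = (\<lambda>\<omega>. S j (Suc n) \<omega> = S j n \<omega> + of_bool (j = i))"
      by blast
    show ?thesis unfolding eq by (intro pred_eq_plus S_measurable True)
  qed simp
  then have "Measurable.pred M (\<lambda>\<omega>. \<forall>j. 1 \<le> j \<longrightarrow> S j (Suc n) \<omega> = S j n \<omega> + of_bool (j = i))"
    by (intro pred_intros_countable)
  then show ?thesis unfolding seats_at_def pred_def .
qed

lemma joins_table_measurable: "1 \<le> i \<Longrightarrow> joins_table M S n i \<in> sets M"
  using seats_at_measurable by (simp add: joins_table_eq)

lemma opens_table_measurable: "opens_table M S n \<in> sets M"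
proof -
  \<comment> \<open>The index of the opened table is random; it is first frozen at
    \<open>k + 1\<close> and then recovered by composition with the countably valued
    \<open>tables n\<close>.\<close>
  have "Measurable.pred M (\<lambda>\<omega>. S (k + 1) (Suc n) \<omega> = 1 \<and> (\<forall>j. 1 \<le> j \<longrightarrow> j \<noteq> k + 1 \<longrightarrow> S j (Suc n) \<omega> = S j n \<omega>))" for k
  proof -
    have "Measurable.pred M (\<lambda>\<omega>. 1 \<le> j \<longrightarrow> j \<noteq> k + 1 \<longrightarrow> S j (Suc n) \<omega> = S j n \<omega>)" for j
    proof (cases "1 \<le> j \<and> j \<noteq> k + 1")
      case True
      then have eq: "(\<lambda>\<omega>. 1 \<le> j \<longrightarrow> j \<noteq> k + 1 \<longrightarrow> S j (Suc n) \<omega> = S j n \<omega>) = (\<lambda>\<omega>. S j (Suc n) \<omega> = S j n \<omega> + 0)"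
        by simp
      show ?thesis unfolding eq by (intro pred_eq_plus S_measurable conjunct1[OF True])
    next
      case False
      then have eq: "(\<lambda>\<omega>. 1 \<le> j \<longrightarrow> j \<noteq> k + 1 \<longrightarrow> S j (Suc n) \<omega> = S j n \<omega>) = (\<lambda>\<omega>. True)"
        by blast
      show ?thesis unfolding eq by simp
    qed
    then have "Measurable.pred M (\<lambda>\<omega>. \<forall>j. 1 \<le> j \<longrightarrow> j \<noteq> k + 1 \<longrightarrow> S j (Suc n) \<omega> = S j n \<omega>)"
      by (intro pred_intros_countable)
    moreover have "Measurable.pred M (\<lambda>\<omega>. S (k + 1) (Suc n) \<omega> = 1)"
      by (rule measurable_compose[OF S_measurable]) simp_all
    ultimately show ?thesis by (intro pred_intros_logic)
  qed
  then have "Measurable.pred M (\<lambda>\<omega>. S (tables n \<omega> + 1) (Suc n) \<omega> = 1 \<and>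
      (\<forall>j. 1 \<le> j \<longrightarrow> j \<noteq> tables n \<omega> + 1 \<longrightarrow> S j (Suc n) \<omega> = S j n \<omega>))"
    by (rule measurable_compose_countable[OF _ K_measurable])
  then show ?thesis unfolding opens_table_def pred_def .
qed

text \<open>The first empty table holds nobody before the step, so having one customer afterwards
  means having gained one.\<close>

lemma opens_table_iff:
  assumes "proper_seating S n \<omega>" "\<omega> \<in> space M"
  shows "\<omega> \<in> opens_table M S n \<longleftrightarrow> seats_at S n (tables n \<omega> + 1) \<omega>"
proof -
  have "S (tables n \<omega> + 1) n \<omega> = 0"
    using assms(1) unfolding proper_seating_def by (metis Suc_eq_plus1 Suc_n_not_le_n le_add2)
  then show ?thesis using assms(2) unfolding opens_table_def seats_at_def by auto
qed

section \<open>One step in conditional expectation\<close>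

text \<open>The real conditional expectation is the difference of those of the positive and negative
  parts. For an indicator the latter is zero and the former at most one, so the conversion to reals
  loses nothing. This makes the prescribed transition probabilities usable in nonnegative
  integrals.\<close>

lemma nn_cond_exp_indicator:
  assumes "J \<in> sets M"
  shows "AE \<omega> in M. nn_cond_exp M (F n) (indicator J) \<omega> = ennreal (real_cond_exp M (F n) (indicator J) \<omega>)"
proof -
  interpret finite_measure_subalgebra M "F n"
    by standard (rule history_subalgebra)
  have eq: "(\<lambda>\<omega>. ennreal (indicator J \<omega>)) = indicator J" by (auto simp: indicator_def)
  have neg: "(\<lambda>\<omega>. ennreal (- indicator J \<omega>)) = (\<lambda>_. 0)" by (auto simp: indicator_def ennreal_neg)
  have "AE \<omega> in M. nn_cond_exp M (F n) (indicator J) \<omega> \<le> nn_cond_exp M (F n) (\<lambda>_. 1) \<omega>"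
    using assms by (intro nn_cond_exp_mono) (auto simp: indicator_def)
  moreover have "AE \<omega> in M. 1 = nn_cond_exp M (F n) (\<lambda>_. 1) \<omega>"
    by (rule nn_cond_exp_F_meas) simp
  moreover have "AE \<omega> in M. 0 = nn_cond_exp M (F n) (\<lambda>_. 0) \<omega>"
    by (rule nn_cond_exp_F_meas) simp
  ultimately show ?thesis
  proof eventually_elim
    case (elim \<omega>)
    then have "nn_cond_exp M (F n) (indicator J) \<omega> < top"
      by (metis ennreal_one_less_top order_le_less_trans)
    then show ?case using elim(3) unfolding real_cond_exp_def eq neg by simp
  qed
qed

text \<open>The defining property of conditional expectation with a history-measurable factor
  \<open>g\<close>. The value \<open>p\<close> is asked for only where \<open>g\<close> is nonzero,
  which matches \<open>prob_joins\<close>, where the probability is prescribed only for occupied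
  tables.\<close>

lemma nn_integral_conditional:
  fixes g :: "'a \<Rightarrow> ennreal" and p :: "'a \<Rightarrow> real"
  assumes J: "J \<in> sets M" and g: "g \<in> borel_measurable (F n)"
    and p: "AE \<omega> in M. g \<omega> \<noteq> 0 \<longrightarrow> real_cond_exp M (F n) (indicator J) \<omega> = p \<omega>"
  shows "(\<integral>\<^sup>+\<omega>. g \<omega> * indicator J \<omega> \<partial>M) = (\<integral>\<^sup>+\<omega>. g \<omega> * ennreal (p \<omega>) \<partial>M)"
proof -
  interpret finite_measure_subalgebra M "F n"
    by standard (rule history_subalgebra)
  have "(\<integral>\<^sup>+\<omega>. g \<omega> * indicator J \<omega> \<partial>M) = (\<integral>\<^sup>+\<omega>. g \<omega> * nn_cond_exp M (F n) (indicator J) \<omega> \<partial>M)"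
    by (rule nn_cond_exp_intg[symmetric]) (use g J in auto)
  also have "\<dots> = (\<integral>\<^sup>+\<omega>. g \<omega> * ennreal (p \<omega>) \<partial>M)"
    by (rule nn_integral_cong_AE) (use nn_cond_exp_indicator[OF J, of n] p in eventually_elim, auto)
  finally show ?thesis .
qed

text \<open>Almost surely at most \<open>n + 1\<close> tables are occupied at time \<open>n\<close>, so a sum up to \<open>n + 1\<close> covers all of them.\<close>

lemma expected_step:
  fixes g :: "nat \<Rightarrow> 'a \<Rightarrow> ennreal"
  assumes g: "\<And>i. 1 \<le> i \<Longrightarrow> g i \<in> borel_measurable (F n)" and g0: "g0 \<in> borel_measurable (F n)"
  shows "(\<integral>\<^sup>+\<omega>. (\<Sum>i = 1..n + 1. of_bool (i \<le> tables n \<omega>) * g i \<omega> * indicator (joins_table M S n i) \<omega>)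
            + g0 \<omega> * indicator (opens_table M S n) \<omega> \<partial>M) =
         (\<integral>\<^sup>+\<omega>. (\<Sum>i = 1..n + 1. of_bool (i \<le> tables n \<omega>) * g i \<omega> * ennreal (W i \<omega> * real (S i n \<omega>) / rate n \<omega>))
            + g0 \<omega> * ennreal (\<theta> / rate n \<omega>) \<partial>M)"
proof -
  have [measurable]: "tables n \<in> measurable (F n) (count_space UNIV)" by (simp add: K_history)
  have h: "(\<lambda>\<omega>. of_bool (i \<le> tables n \<omega>) * g i \<omega>) \<in> borel_measurable (F n)" if "1 \<le> i" for i
  proof -
    note [measurable] = g[OF that]
    show ?thesis by measurable
  qed
  have hM: "(\<lambda>\<omega>. of_bool (i \<le> tables n \<omega>) * g i \<omega>) \<in> borel_measurable M" if "1 \<le> i" for i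
    using measurable_from_subalg[OF history_subalgebra h[OF that]] .
  have g0M: "g0 \<in> borel_measurable M" using measurable_from_subalg[OF history_subalgebra g0] .
  have jM: "joins_table M S n i \<in> sets M" if "1 \<le> i" for i using joins_table_measurable[OF that] .
  note [measurable] = opens_table_measurable[of n] g0M measurable_from_subalg[OF history_subalgebra R_history[OF le_refl]]
  have sM: "(\<lambda>\<omega>. ennreal (W i \<omega> * real (S i n \<omega>) / rate n \<omega>)) \<in> borel_measurable M" if "1 \<le> i" for i
  proof -
    note [measurable] = W_measurable[OF that] S_measurable[OF that]
    show ?thesis by measurable
  qed
  have "(\<integral>\<^sup>+\<omega>. (\<Sum>i = 1..n + 1. of_bool (i \<le> tables n \<omega>) * g i \<omega> * indicator (joins_table M S n i) \<omega>)
            + g0 \<omega> * indicator (opens_table M S n) \<omega> \<partial>M) =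
     (\<Sum>i = 1..n + 1. \<integral>\<^sup>+\<omega>. of_bool (i \<le> tables n \<omega>) * g i \<omega> * indicator (joins_table M S n i) \<omega> \<partial>M) +
     (\<integral>\<^sup>+\<omega>. g0 \<omega> * indicator (opens_table M S n) \<omega> \<partial>M)"
    by (subst nn_integral_add, (intro borel_measurable_sum borel_measurable_times_ennreal borel_measurable_indicator hM jM; simp), measurable)
      (subst nn_integral_sum, (intro borel_measurable_times_ennreal borel_measurable_indicator hM jM; simp), simp)
  also have "\<dots> = (\<Sum>i = 1..n + 1. \<integral>\<^sup>+\<omega>. of_bool (i \<le> tables n \<omega>) * g i \<omega> * ennreal (W i \<omega> * real (S i n \<omega>) / rate n \<omega>) \<partial>M) +
     (\<integral>\<^sup>+\<omega>. g0 \<omega> * ennreal (\<theta> / rate n \<omega>) \<partial>M)"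
  proof (intro arg_cong2[where f = "(+)"] sum.cong refl)
    fix i assume "i \<in> {1..n + 1}"
    then have i: "1 \<le> i" by simp
    show "(\<integral>\<^sup>+\<omega>. of_bool (i \<le> tables n \<omega>) * g i \<omega> * indicator (joins_table M S n i) \<omega> \<partial>M) =
      (\<integral>\<^sup>+\<omega>. of_bool (i \<le> tables n \<omega>) * g i \<omega> * ennreal (W i \<omega> * real (S i n \<omega>) / rate n \<omega>) \<partial>M)"
      by (rule nn_integral_conditional[OF jM[OF i] h[OF i]])
        (use prob_joins[OF i, of n] in \<open>eventually_elim, auto\<close>)
  next
    show "(\<integral>\<^sup>+\<omega>. g0 \<omega> * indicator (opens_table M S n) \<omega> \<partial>M) = (\<integral>\<^sup>+\<omega>. g0 \<omega> * ennreal (\<theta> / rate n \<omega>) \<partial>M)"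
      by (rule nn_integral_conditional[OF opens_table_measurable g0])
        (use prob_opens[of n] in \<open>eventually_elim, auto\<close>)
  qed
  also have "\<dots> = (\<integral>\<^sup>+\<omega>. (\<Sum>i = 1..n + 1. of_bool (i \<le> tables n \<omega>) * g i \<omega> * ennreal (W i \<omega> * real (S i n \<omega>) / rate n \<omega>))
            + g0 \<omega> * ennreal (\<theta> / rate n \<omega>) \<partial>M)"
    by (subst nn_integral_add, (intro borel_measurable_sum borel_measurable_times_ennreal hM sM; simp), measurable)
      (subst nn_integral_sum, (intro borel_measurable_times_ennreal hM sM; simp), simp)
  finally show ?thesis .
qed

section \<open>Almost sure properties of the weights\<close>

abbreviation "s \<equiv> esssup \<mu> ereal"

lemma AE_weight:
  assumes "1 \<le> i" "AE w in \<mu>. P w" shows "AE \<omega> in M. P (W i \<omega>)"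
proof (rule AE_distrD[OF W_measurable[OF assms(1)]])
  show "AE w in distr M borel (W i). P w" unfolding weights_distr[OF assms(1)] by (rule assms(2))
qed

lemma AE_weights_pos: "AE \<omega> in M. \<forall>i\<ge>1. 0 < W i \<omega>"
proof -
  have "AE \<omega> in M. 1 \<le> i \<longrightarrow> 0 < W i \<omega>" for i
    using AE_weight[OF _ weight_pos, of i] by (cases "1 \<le> i") auto
  then show ?thesis by (simp add: AE_all_countable)
qed

text \<open>A weight is almost surely at most the essential supremum, and \<open>no_atom\<close>
  excludes equality.\<close>

lemma AE_weights_less: "AE \<omega> in M. \<forall>i\<ge>1. ereal (W i \<omega>) < s"
proof -
  interpret mu: real_distribution \<mu> by (rule weight_law)
  have [measurable]: "ereal \<in> borel_measurable \<mu>" by simp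
  have "{w \<in> space \<mu>. ereal w = s} \<in> sets \<mu>" by measurable
  then have ms: "{w. ereal w = s} \<in> sets \<mu>" by simp
  have "AE w in \<mu>. w \<notin> {w. ereal w = s}"
    by (intro AE_not_in) (use no_atom ms in \<open>simp add: null_sets_def mu.emeasure_eq_measure\<close>)
  then have "AE w in \<mu>. ereal w < s"
    using esssup_AE[of ereal \<mu>] by eventually_elim auto
  then have "AE \<omega> in M. 1 \<le> i \<longrightarrow> ereal (W i \<omega>) < s" for i
    using AE_weight[of i "\<lambda>w. ereal w < s"] by (cases "1 \<le> i") auto
  then show ?thesis by (simp add: AE_all_countable)
qed

text \<open>By definition of the essential supremum each weight is at most \<open>v\<close> with a
  probability \<open>q < 1\<close>; by independence the first \<open>n\<close> weights all are with
  probability \<open>q ^ n\<close>, which tends to zero.\<close>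

lemma AE_exists_heavy:
  assumes "ereal v < s" shows "AE \<omega> in M. \<exists>j\<ge>1. v < W j \<omega>"
proof -
  interpret mu: real_distribution \<mu> by (rule weight_law)
  have "0 < emeasure \<mu> {w \<in> space \<mu>. ereal v < ereal w}"
    by (rule esssup_pos_measure) (use assms in auto)
  then have p: "0 < measure \<mu> {v<..}"
    by (simp add: mu.emeasure_eq_measure greaterThan_def)
  define q where "q = measure \<mu> {..v}"
  have "measure \<mu> {..v} + measure \<mu> {v<..} = measure \<mu> ({..v} \<union> {v<..})"
    by (intro mu.finite_measure_Union[symmetric]) auto
  also have "{..v} \<union> {v<..} = space \<mu>" by auto
  finally have "q + measure \<mu> {v<..} = 1" unfolding q_def mu.prob_space .
  then have q: "q < 1" "0 \<le> q" using p by (auto simp: q_def)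
  have single: "prob (W j -` {..v} \<inter> space M) = q" if "1 \<le> j" for j
    using weights_distr[OF that] measure_distr[OF W_measurable[OF that], of "{..v}"] by (simp add: q_def)
  define N where "N = {\<omega> \<in> space M. \<forall>j\<ge>1. W j \<omega> \<le> v}"
  have N_eq: "N = (\<Inter>j\<in>{1..}. W j -` {..v} \<inter> space M)" by (auto simp: N_def)
  have NM: "N \<in> sets M" unfolding N_eq
    by (intro sets.countable_INT') (auto intro!: measurable_sets W_measurable)
  have "prob N \<le> q ^ n" for n
  \<comment> \<open>The product formula for independent variables concerns nonempty index sets; for
    \<open>n = 0\<close> the bound is one.\<close>
  proof (cases "n = 0")
    case False
    have "prob N \<le> prob (\<Inter>j\<in>{1..n}. W j -` {..v} \<inter> space M)"
      using False by (intro finite_measure_mono sets.finite_INT measurable_sets[OF W_measurable]) (auto simp: N_eq)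
    also have "\<dots> = (\<Prod>j\<in>{1..n}. prob (W j -` {..v} \<inter> space M))"
      by (rule indep_varsD[OF weights_indep]) (use False in auto)
    also have "\<dots> = q ^ n" using single by simp
    finally show ?thesis .
  qed simp
  moreover have "(\<lambda>n. q ^ n) \<longlonglongrightarrow> 0" using q by (intro LIMSEQ_power_zero) simp
  ultimately have "prob N \<le> 0" by (intro LIMSEQ_le_const) auto
  then have "prob N = 0" using measure_nonneg[of M N] by linarith
  then have "AE \<omega> in M. \<omega> \<notin> N" using NM by (intro AE_not_in) (simp add: null_sets_def emeasure_eq_measure)
  then show ?thesis by (rule AE_mp) (auto simp: N_def not_le)
qed

section \<open>Almost every path is valid\<close>

text \<open>A step determines the table that gains a customer, so exactly one summand survives. The
  factor \<open>of_bool (j \<le> tables n \<omega>)\<close> prevents double counting, since opening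
  a table also belongs to \<open>joins_table\<close> for the first empty table.\<close>

lemma step_sum_eval:
  fixes g :: "nat \<Rightarrow> ennreal"
  assumes ps: "proper_seating S n \<omega>" and sp: "\<omega> \<in> space M"
    and i: "1 \<le> i" "i \<le> tables n \<omega> + 1" and seat: "seats_at S n i \<omega>"
  shows "(\<Sum>j = 1..n + 1. of_bool (j \<le> tables n \<omega>) * g j * indicator (joins_table M S n j) \<omega>)
      + g0 * indicator (opens_table M S n) \<omega> = (if i \<le> tables n \<omega> then g i else g0)"
proof -
  have uniq: "seats_at S n j \<omega> \<longleftrightarrow> j = i" if "1 \<le> j" for j
  proof
    assume j: "seats_at S n j \<omega>"
    have "S i (Suc n) \<omega> = S i n \<omega> + of_bool (i = j)" using j i(1) unfolding seats_at_def by blast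
    moreover have "S i (Suc n) \<omega> = S i n \<omega> + of_bool (i = i)" using seat i(1) unfolding seats_at_def by blast
    ultimately show "j = i" by (cases "i = j") auto
  qed (use seat in simp)
  have tables: "tables n \<omega> \<le> n + 1" using ps by (simp add: proper_seating_def)
  have "(\<Sum>j = 1..n + 1. of_bool (j \<le> tables n \<omega>) * g j * indicator (joins_table M S n j) \<omega>) =
    (\<Sum>j = 1..n + 1. of_bool (j \<le> tables n \<omega>) * g j * of_bool (j = i))"
    by (intro sum.cong refl) (use uniq sp in \<open>auto simp: joins_table_eq\<close>)
  also have "\<dots> = (if i \<le> tables n \<omega> then g i else 0)"
  proof (cases "i \<le> tables n \<omega>")
    case True
    then have "i \<in> {1..n + 1}" using tables i by auto
    then show ?thesis using True unfolding sum_of_bool_eq[OF \<open>i \<in> {1..n + 1}\<close>] by simp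
  qed (auto intro!: sum.neutral)
  finally show ?thesis using opens_table_iff[OF ps sp] uniq[of "tables n \<omega> + 1"] i
    by (auto simp: indicator_def)
qed

text \<open>Averages the values \<open>u\<close> and \<open>z\<close> with the transition
  probabilities and collects the result in one real number, for comparison with a real drift
  inequality. The factor \<open>b\<close> will be the indicator of a history event.\<close>

lemma rate_sum_eval:
  fixes u :: "nat \<Rightarrow> real"
  assumes ps: "proper_seating S n \<omega>" and W: "\<And>i. 1 \<le> i \<Longrightarrow> 0 < W i \<omega>"
    and u: "\<And>i. 1 \<le> i \<Longrightarrow> 0 \<le> u i" "0 \<le> z"
  shows "(\<Sum>i = 1..n + 1. of_bool (i \<le> tables n \<omega>) * (ennreal (u i) * b) * ennreal (W i \<omega> * real (S i n \<omega>) / rate n \<omega>))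
      + ennreal z * b * ennreal (\<theta> / rate n \<omega>)
    = ennreal (((\<Sum>i = 1..tables n \<omega>. W i \<omega> * real (S i n \<omega>) * u i) + \<theta> * z) / rate n \<omega>) * b"
proof -
  have tables: "tables n \<omega> \<le> n + 1" using ps by (simp add: proper_seating_def)
  have rate: "0 < rate n \<omega>" unfolding total_rate_def
    using theta_pos by (intro add_pos_nonneg sum_nonneg mult_nonneg_nonneg less_imp_le[OF W]) auto
  have p: "0 \<le> W i \<omega> * real (S i n \<omega>) / rate n \<omega>" if "1 \<le> i" for i
    using W[OF that] rate by simp
  have "(\<Sum>i = 1..n + 1. of_bool (i \<le> tables n \<omega>) * (ennreal (u i) * b) * ennreal (W i \<omega> * real (S i n \<omega>) / rate n \<omega>))
      = (\<Sum>i = 1..tables n \<omega>. of_bool (i \<le> tables n \<omega>) * (ennreal (u i) * b) * ennreal (W i \<omega> * real (S i n \<omega>) / rate n \<omega>))"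
    using tables by (intro sum.mono_neutral_right) auto
  also have "\<dots> = (\<Sum>i = 1..tables n \<omega>. ennreal (W i \<omega> * real (S i n \<omega>) / rate n \<omega> * u i) * b)"
    by (intro sum.cong refl) (use u p in \<open>simp add: ennreal_mult mult_ac del: times_divide_eq_left times_divide_eq_right\<close>)
  also have "\<dots> = ennreal (\<Sum>i = 1..tables n \<omega>. W i \<omega> * real (S i n \<omega>) / rate n \<omega> * u i) * b"
    unfolding sum_distrib_right[symmetric] by (subst sum_ennreal) (auto intro!: mult_nonneg_nonneg p u simp del: times_divide_eq_left times_divide_eq_right)
  finally have 1: "(\<Sum>i = 1..n + 1. of_bool (i \<le> tables n \<omega>) * (ennreal (u i) * b) * ennreal (W i \<omega> * real (S i n \<omega>) / rate n \<omega>))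
      = ennreal (\<Sum>i = 1..tables n \<omega>. W i \<omega> * real (S i n \<omega>) / rate n \<omega> * u i) * b" .
  have 2: "ennreal z * b * ennreal (\<theta> / rate n \<omega>) = ennreal (\<theta> / rate n \<omega> * z) * b"
    using u(2) theta_pos rate by (simp add: ennreal_mult mult_ac del: times_divide_eq_left times_divide_eq_right)
  have "(\<Sum>i = 1..tables n \<omega>. W i \<omega> * real (S i n \<omega>) / rate n \<omega> * u i) + \<theta> / rate n \<omega> * z =
    ((\<Sum>i = 1..tables n \<omega>. W i \<omega> * real (S i n \<omega>) * u i) + \<theta> * z) / rate n \<omega>"
    by (simp add: add_divide_distrib sum_divide_distrib)
  moreover have "0 \<le> (\<Sum>i = 1..tables n \<omega>. W i \<omega> * real (S i n \<omega>) / rate n \<omega> * u i)"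
    by (intro sum_nonneg mult_nonneg_nonneg p u) auto
  moreover have "0 \<le> \<theta> / rate n \<omega> * z" using u(2) theta_pos rate by simp
  ultimately show ?thesis unfolding 1 2 distrib_right[symmetric] by (simp only: ennreal_plus[symmetric])
qed

text \<open>The prescribed conditional probabilities add up to one, so no other transition occurs.\<close>

lemma AE_valid_step:
  assumes "AE \<omega> in M. proper_seating S n \<omega>"
  shows "AE \<omega> in M. valid_step S n \<omega>"
proof -
  define U where "U = (\<Union>i\<in>{1..n + 1}. {\<omega> \<in> space M. i \<le> tables n \<omega>} \<inter> joins_table M S n i) \<union> opens_table M S n"
  have "{\<omega> \<in> space M. i \<le> tables n \<omega>} \<in> sets M" for i by measurable
  then have UM: "U \<in> sets M" unfolding U_def
    by (intro sets.Un sets.finite_UN sets.Int joins_table_measurable opens_table_measurable) auto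
  \<comment> \<open>\<open>f\<close> counts the admissible transitions that take place. Its
    expectation is one, and on proper seatings it is at most the indicator of \<open>U\<close>;
    hence \<open>U\<close> has probability one.\<close>
  define f :: "'a \<Rightarrow> ennreal" where
    "f \<omega> = (\<Sum>i = 1..n + 1. of_bool (i \<le> tables n \<omega>) * 1 * indicator (joins_table M S n i) \<omega>) + 1 * indicator (opens_table M S n) \<omega>" for \<omega>
  have "(\<integral>\<^sup>+\<omega>. f \<omega> \<partial>M) = (\<integral>\<^sup>+\<omega>. (\<Sum>i = 1..n + 1. of_bool (i \<le> tables n \<omega>) * 1 * ennreal (W i \<omega> * real (S i n \<omega>) / rate n \<omega>))
            + 1 * ennreal (\<theta> / rate n \<omega>) \<partial>M)"
    unfolding f_def by (rule expected_step) auto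
  also have "\<dots> = (\<integral>\<^sup>+\<omega>. 1 \<partial>M)"
  proof (rule nn_integral_cong_AE)
    show "AE \<omega> in M. (\<Sum>i = 1..n + 1. of_bool (i \<le> tables n \<omega>) * 1 * ennreal (W i \<omega> * real (S i n \<omega>) / rate n \<omega>))
            + 1 * ennreal (\<theta> / rate n \<omega>) = 1"
      using assms AE_weights_pos
    proof eventually_elim
      case (elim \<omega>)
      have rate: "0 < rate n \<omega>" unfolding total_rate_def
        using theta_pos elim(2) by (intro add_pos_nonneg sum_nonneg mult_nonneg_nonneg) (auto intro: less_imp_le)
      have "((\<Sum>i = 1..tables n \<omega>. W i \<omega> * real (S i n \<omega>) * 1) + \<theta> * 1) / rate n \<omega> = 1"
        using rate by (simp add: total_rate_def add.commute)
      then show ?case using rate_sum_eval[OF elim(1), of "\<lambda>_. 1" 1 1] elim(2) by simp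
    qed
  qed
  finally have int1: "(\<integral>\<^sup>+\<omega>. f \<omega> \<partial>M) = 1" by (simp add: emeasure_space_1)
  have le: "AE \<omega> in M. f \<omega> \<le> indicator U \<omega>"
    using assms AE_space
  proof eventually_elim
    case (elim \<omega>)
    show ?case
    proof (cases "\<omega> \<in> U")
      case True
      then obtain i where i: "1 \<le> i" "i \<le> tables n \<omega> + 1" "seats_at S n i \<omega>"
        using opens_table_iff[OF elim] unfolding U_def by (auto simp: joins_table_eq)
      show ?thesis using step_sum_eval[OF elim i, of "\<lambda>_. 1" 1] True by (simp add: f_def)
    next
      case False
      have "of_bool (i \<le> tables n \<omega>) * 1 * indicator (joins_table M S n i) \<omega> = (0::ennreal)" if "i \<in> {1..n + 1}" for i
        using False that elim(2) unfolding U_def by (auto simp: indicator_def)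
      moreover have "\<omega> \<notin> opens_table M S n" using False by (simp add: U_def)
      ultimately show ?thesis by (simp add: f_def del: sum.cl_ivl_Suc)
    qed
  qed
  have "1 \<le> emeasure M U"
    using nn_integral_mono_AE[OF le] UM by (simp add: int1)
  then have "1 \<le> prob U" by (simp add: emeasure_eq_measure)
  then have "prob U = 1" using prob_le_1[of U] by linarith
  then have "AE \<omega> in M. \<omega> \<in> U" by (rule AE_prob_1)
  then show ?thesis using assms AE_space
  proof eventually_elim
    case (elim \<omega>)
    then obtain i where "1 \<le> i" "i \<le> tables n \<omega> + 1" "seats_at S n i \<omega>"
      using opens_table_iff[OF elim(2,3)] unfolding U_def by (auto simp: joins_table_eq)
    then show ?case unfolding valid_step_def by auto
  qed
qed

lemma AE_valid_start: "AE \<omega> in M. valid_start S \<omega>"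
  using S_init unfolding valid_start_def by simp

text \<open>The induction alternates: a proper seating at time \<open>n\<close> makes the next step
  valid, and a valid step preserves properness.\<close>

lemma AE_proper: "AE \<omega> in M. proper_seating S n \<omega>"
proof (induction n)
  case 0
  show ?case using AE_valid_start by eventually_elim (rule proper_seating_0)
next
  case (Suc n)
  show ?case using Suc.IH AE_valid_step[OF Suc.IH] by eventually_elim (rule proper_seating_Suc)
qed

lemma AE_valid_path: "AE \<omega> in M. valid_path \<theta> W S \<omega>"
proof -
  have "AE \<omega> in M. \<forall>n. valid_step S n \<omega>"
    using AE_valid_step[OF AE_proper] by (simp add: AE_all_countable)
  then show ?thesis using AE_valid_start AE_weights_pos
    by eventually_elim (use theta_pos in \<open>auto simp: valid_path_def\<close>)
qed

text \<open>
  \<open>u n i\<close> and \<open>z n\<close> bound the value of \<open>X\<close> at time \<open>n + 1\<close> if the step from \<open>n\<close> joins table \<open>i\<close> or opens a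
  table; \<open>drift\<close> says that the resulting conditional expectation is at most \<open>X n\<close>.
\<close>

lemma bounded_by_drift:
  fixes X z :: "nat \<Rightarrow> 'a \<Rightarrow> real" and u :: "nat \<Rightarrow> nat \<Rightarrow> 'a \<Rightarrow> real"
  assumes X: "\<And>n. l \<le> n \<Longrightarrow> X n \<in> borel_measurable (F n)"
    and u: "\<And>n i. l \<le> n \<Longrightarrow> 1 \<le> i \<Longrightarrow> u n i \<in> borel_measurable (F n)"
    and z: "\<And>n. l \<le> n \<Longrightarrow> z n \<in> borel_measurable (F n)"
    and u_nonneg: "\<And>\<omega> n i. valid_path \<theta> W S \<omega> \<Longrightarrow> l \<le> n \<Longrightarrow> 1 \<le> i \<Longrightarrow> 0 \<le> u n i \<omega>"
    and z_nonneg: "\<And>\<omega> n. valid_path \<theta> W S \<omega> \<Longrightarrow> l \<le> n \<Longrightarrow> 0 \<le> z n \<omega>"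
    and joins: "\<And>\<omega> n i. valid_path \<theta> W S \<omega> \<Longrightarrow> l \<le> n \<Longrightarrow> 1 \<le> i \<Longrightarrow> i \<le> tables n \<omega> \<Longrightarrow>
      seats_at S n i \<omega> \<Longrightarrow> X (Suc n) \<omega> \<le> u n i \<omega>"
    and opens: "\<And>\<omega> n. valid_path \<theta> W S \<omega> \<Longrightarrow> l \<le> n \<Longrightarrow>
      seats_at S n (tables n \<omega> + 1) \<omega> \<Longrightarrow> X (Suc n) \<omega> \<le> z n \<omega>"
    and drift: "\<And>\<omega> n. valid_path \<theta> W S \<omega> \<Longrightarrow> l \<le> n \<Longrightarrow>
      (\<Sum>i = 1..tables n \<omega>. W i \<omega> * real (S i n \<omega>) * u n i \<omega>) + \<theta> * z n \<omega> \<le> rate n \<omega> * X n \<omega>"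
    and init: "\<And>\<omega>. valid_path \<theta> W S \<omega> \<Longrightarrow> X l \<omega> \<le> c"
  shows "AE \<omega> in M. \<exists>C. \<forall>n\<ge>l. X n \<omega> \<le> C"
proof -
  have decr: "(\<integral>\<^sup>+\<omega>\<in>B. ennreal (X (Suc n) \<omega>) \<partial>M) \<le> (\<integral>\<^sup>+\<omega>\<in>B. ennreal (X n \<omega>) \<partial>M)"
    if B: "B \<in> sets (F n)" and n: "l \<le> n" for B n
  proof -
    \<comment> \<open>On a valid path exactly one transition occurs, and \<open>X (Suc n)\<close> is
      bounded by the value assigned to it. Its indicator can then be replaced by its conditional
      probability.\<close>
    have "(\<integral>\<^sup>+\<omega>\<in>B. ennreal (X (Suc n) \<omega>) \<partial>M) \<le>
      (\<integral>\<^sup>+\<omega>. (\<Sum>i = 1..n + 1. of_bool (i \<le> tables n \<omega>) * (ennreal (u n i \<omega>) * indicator B \<omega>) * indicator (joins_table M S n i) \<omega>)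
            + (ennreal (z n \<omega>) * indicator B \<omega>) * indicator (opens_table M S n) \<omega> \<partial>M)"
    proof (rule nn_integral_mono_AE)
      show "AE \<omega> in M. ennreal (X (Suc n) \<omega>) * indicator B \<omega> \<le>
        (\<Sum>i = 1..n + 1. of_bool (i \<le> tables n \<omega>) * (ennreal (u n i \<omega>) * indicator B \<omega>) * indicator (joins_table M S n i) \<omega>)
            + (ennreal (z n \<omega>) * indicator B \<omega>) * indicator (opens_table M S n) \<omega>"
        using AE_valid_path AE_space
      proof eventually_elim
        case (elim \<omega>)
        interpret valid_path \<theta> W S \<omega> by (rule elim(1))
        obtain i where i: "1 \<le> i" "i \<le> tables n \<omega> + 1" "seats_at S n i \<omega>"
          using step[of n] unfolding valid_step_def by auto
        have "ennreal (X (Suc n) \<omega>) * indicator B \<omega> \<le> (if i \<le> tables n \<omega> then ennreal (u n i \<omega>) * indicator B \<omega> else ennreal (z n \<omega>) * indicator B \<omega>)"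
        proof (cases "i \<le> tables n \<omega>")
          case True
          then show ?thesis using joins[OF elim(1) n i(1) True i(3)]
            by (auto intro!: mult_right_mono ennreal_leI)
        next
          case False
          then have "i = tables n \<omega> + 1" using i by simp
          then show ?thesis using opens[OF elim(1) n] i(3)
            by (auto intro!: mult_right_mono ennreal_leI)
        qed
        then show ?case
          using step_sum_eval[OF proper elim(2) i, of "\<lambda>i. ennreal (u n i \<omega>) * indicator B \<omega>" "ennreal (z n \<omega>) * indicator B \<omega>"]
          by simp
      qed
    qed
    also have "\<dots> = (\<integral>\<^sup>+\<omega>. (\<Sum>i = 1..n + 1. of_bool (i \<le> tables n \<omega>) * (ennreal (u n i \<omega>) * indicator B \<omega>) * ennreal (W i \<omega> * real (S i n \<omega>) / rate n \<omega>))
            + (ennreal (z n \<omega>) * indicator B \<omega>) * ennreal (\<theta> / rate n \<omega>) \<partial>M)"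
    proof (rule expected_step)
      show "(\<lambda>\<omega>. ennreal (u n i \<omega>) * indicator B \<omega>) \<in> borel_measurable (F n)" if "1 \<le> i" for i
        using u[OF n that] B by (intro borel_measurable_times_ennreal borel_measurable_indicator measurable_compose[OF _ measurable_ennreal])
      show "(\<lambda>\<omega>. ennreal (z n \<omega>) * indicator B \<omega>) \<in> borel_measurable (F n)"
        using z[OF n] B by (intro borel_measurable_times_ennreal borel_measurable_indicator measurable_compose[OF _ measurable_ennreal])
    qed
    also have "\<dots> \<le> (\<integral>\<^sup>+\<omega>\<in>B. ennreal (X n \<omega>) \<partial>M)"
    proof (rule nn_integral_mono_AE)
      show "AE \<omega> in M. (\<Sum>i = 1..n + 1. of_bool (i \<le> tables n \<omega>) * (ennreal (u n i \<omega>) * indicator B \<omega>) * ennreal (W i \<omega> * real (S i n \<omega>) / rate n \<omega>))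
            + (ennreal (z n \<omega>) * indicator B \<omega>) * ennreal (\<theta> / rate n \<omega>) \<le> ennreal (X n \<omega>) * indicator B \<omega>"
        using AE_valid_path
      proof eventually_elim
        case (elim \<omega>)
        interpret valid_path \<theta> W S \<omega> by (rule elim)
        have "((\<Sum>i = 1..tables n \<omega>. W i \<omega> * real (S i n \<omega>) * u n i \<omega>) + \<theta> * z n \<omega>) / rate n \<omega> \<le> X n \<omega>"
          using drift[OF elim n] R_pos[of n] by (simp add: divide_le_eq mult.commute)
        then show ?case
          by (subst rate_sum_eval[OF proper W_pos u_nonneg[OF elim n] z_nonneg[OF elim n]])
            (auto intro!: mult_right_mono ennreal_leI)
      qed
    qed
    finally show ?thesis .
  qed
  \<comment> \<open>Time is shifted by \<open>l\<close>, so that the maximal inequality applies to a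
    process starting at zero.\<close>
  have "AE \<omega> in M. \<exists>C. \<forall>n. X (l + n) \<omega> \<le> C"
  proof (rule supermartingale_bounded[where G = "\<lambda>n. F (l + n)"])
    have "(\<integral>\<^sup>+\<omega>. ennreal (X (l + 0) \<omega>) \<partial>M) \<le> (\<integral>\<^sup>+\<omega>. ennreal c \<partial>M)"
      by (rule nn_integral_mono_AE) (use AE_valid_path in \<open>eventually_elim, auto intro: ennreal_leI init\<close>)
    also have "\<dots> < \<infinity>" by (simp add: emeasure_space_1)
    finally show "(\<integral>\<^sup>+\<omega>. ennreal (X (l + 0) \<omega>) \<partial>M) < \<infinity>" .
  qed (use X decr history_mono history_subalgebra in auto)
  then show ?thesis
  proof eventually_elim
    case (elim \<omega>)
    then obtain C where "\<And>n. X (l + n) \<omega> \<le> C" by blast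
    then have "X n \<omega> \<le> C" if "l \<le> n" for n using that by (metis le_add_diff_inverse)
    then show ?case by blast
  qed
qed

section \<open>The three families of supermartingales\<close>

text \<open>A table opens with probability \<theta> / R and then multiplies
  \<open>exp (c * K)\<close> by \<open>exp c\<close>, so the conditional mean grows by the factor
  \<open>1 + b / R\<close> \<le> \<open>exp (b / R)\<close>, which the clock compensates.\<close>

lemma AE_bdd_tables:
  fixes c :: real
  shows "AE \<omega> in M. \<exists>C. \<forall>n\<ge>0. exp (c * real (tables n \<omega>) - (exp c - 1) * \<theta> * clock n \<omega>) \<le> C"
proof -
  define b where "b = (exp c - 1) * \<theta>"
  \<comment> \<open>The value at time \<open>n + 1\<close> if no table opens. The clock at
    \<open>n + 1\<close> is spelled out through quantities known at time \<open>n\<close>.\<close>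
  let ?D = "\<lambda>n \<omega>. exp (c * real (tables n \<omega>) - b * (clock n \<omega> + 1 / rate n \<omega>))"
  have "AE \<omega> in M. \<exists>C. \<forall>n\<ge>0. exp (c * real (tables n \<omega>) - b * clock n \<omega>) \<le> C"
  proof (rule bounded_by_drift[where u = "\<lambda>n i. ?D n" and z = "\<lambda>n \<omega>. exp c * ?D n \<omega>" and c = "exp c"])
    fix n
    note [measurable] = K_history[OF le_refl, of n] A_history[OF le_refl, of n] R_history[OF le_refl, of n]
    show "(\<lambda>\<omega>. exp (c * real (tables n \<omega>) - b * clock n \<omega>)) \<in> borel_measurable (F n)"
      "?D n \<in> borel_measurable (F n)"
      "(\<lambda>\<omega>. exp c * ?D n \<omega>) \<in> borel_measurable (F n)" by measurable
  next
    fix \<omega> n i assume v: "valid_path \<theta> W S \<omega>" and i: "1 \<le> i" "i \<le> tables n \<omega>" "seats_at S n i \<omega>"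
    interpret valid_path \<theta> W S \<omega> by (rule v)
    have "tables (Suc n) \<omega> = tables n \<omega>" using num_tables_Suc[OF proper _ i(3)] i by simp
    then show "exp (c * real (tables (Suc n) \<omega>) - b * clock (Suc n) \<omega>) \<le> ?D n \<omega>" by (simp add: A_Suc)
  next
    fix \<omega> n assume v: "valid_path \<theta> W S \<omega>" and i: "seats_at S n (tables n \<omega> + 1) \<omega>"
    interpret valid_path \<theta> W S \<omega> by (rule v)
    have "tables (Suc n) \<omega> = tables n \<omega> + 1" using num_tables_Suc[OF proper _ i] by simp
    then show "exp (c * real (tables (Suc n) \<omega>) - b * clock (Suc n) \<omega>) \<le> exp c * ?D n \<omega>"
      by (simp add: A_Suc exp_add[symmetric] algebra_simps)
  next
    fix \<omega> n assume v: "valid_path \<theta> W S \<omega>"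
    interpret valid_path \<theta> W S \<omega> by (rule v)
    have "(\<Sum>i = 1..tables n \<omega>. W i \<omega> * real (S i n \<omega>) * ?D n \<omega>) + \<theta> * (exp c * ?D n \<omega>) = (rate n \<omega> + b) * ?D n \<omega>"
      unfolding sum_distrib_right[symmetric] weighted_total by (simp add: b_def algebra_simps)
    also have "\<dots> \<le> rate n \<omega> * exp (b * (1 / rate n \<omega>)) * ?D n \<omega>"
      by (intro mult_right_mono one_plus_le_exp) simp
    also have "\<dots> = rate n \<omega> * exp (c * real (tables n \<omega>) - b * clock n \<omega>)"
      by (simp add: exp_add[symmetric] algebra_simps)
    finally show "(\<Sum>i = 1..tables n \<omega>. W i \<omega> * real (S i n \<omega>) * ?D n \<omega>) + \<theta> * (exp c * ?D n \<omega>)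
      \<le> rate n \<omega> * exp (c * real (tables n \<omega>) - b * clock n \<omega>)" .
  next
    fix \<omega> assume v: "valid_path \<theta> W S \<omega>"
    interpret valid_path \<theta> W S \<omega> by (rule v)
    have "tables 0 \<omega> = 1" using K_pos[of 0] K_le[of 0] by simp
    then show "exp (c * real (tables 0 \<omega>) - b * clock 0 \<omega>) \<le> exp c" by (simp add: cum_rate_def)
  qed auto
  then show ?thesis by (simp add: b_def)
qed

text \<open>Light customers arrive with probability at most (v * L + \<theta>) / R. Adding \<theta>
  / v to \<open>L\<close> turns the numerator into \<open>v\<close> times the shifted count, so that
  growth is purely exponential.\<close>

lemma AE_bdd_light:
  assumes v: "0 < v"
  shows "AE \<omega> in M. \<exists>C. \<forall>n\<ge>0. (light_customers v W S n \<omega> + \<theta> / v) * exp (- v * clock n \<omega>) \<le> C"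
proof -
  let ?L = "\<lambda>n \<omega>. light_customers v W S n \<omega> + \<theta> / v"
  let ?D = "\<lambda>n \<omega>. exp (- v * (clock n \<omega> + 1 / rate n \<omega>))"
  have L0: "0 \<le> light_customers v W S n \<omega>" for n \<omega>
    unfolding light_customers_def by (intro sum_nonneg) auto
  have L_Suc: "light_customers v W S (Suc n) \<omega> = light_customers v W S n \<omega> + of_bool (W i \<omega> < v)"
    if "valid_path \<theta> W S \<omega>" "1 \<le> i" "i \<le> tables n \<omega> + 1" "seats_at S n i \<omega>" for \<omega> n i
    unfolding light_customers_def
    using proper_seating_sum[OF valid_path.proper[OF that(1)], of i n "\<lambda>j x. of_bool (W j \<omega> < v) * real x"] that
    by (simp add: algebra_simps)
  show ?thesis
  proof (rule bounded_by_drift[where u = "\<lambda>n i \<omega>. (?L n \<omega> + of_bool (W i \<omega> < v)) * ?D n \<omega>"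
        \<comment> \<open>A newly opened table is counted as light whatever its weight, so
          \<open>z\<close> is an upper bound.\<close>
        and z = "\<lambda>n \<omega>. (?L n \<omega> + 1) * ?D n \<omega>" and c = "1 + \<theta> / v"])
    fix n
    note [measurable] = light_history[OF le_refl, of v n] A_history[OF le_refl, of n] R_history[OF le_refl, of n]
    show "(\<lambda>\<omega>. ?L n \<omega> * exp (- v * clock n \<omega>)) \<in> borel_measurable (F n)"
      "(\<lambda>\<omega>. (?L n \<omega> + 1) * ?D n \<omega>) \<in> borel_measurable (F n)" by measurable
    fix i :: nat assume i: "1 \<le> i"
    note [measurable] = W_history[OF i, of n]
    show "(\<lambda>\<omega>. (?L n \<omega> + of_bool (W i \<omega> < v)) * ?D n \<omega>) \<in> borel_measurable (F n)" by measurable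
  next
    fix \<omega> n i
    show "0 \<le> (?L n \<omega> + of_bool (W i \<omega> < v)) * ?D n \<omega>" "0 \<le> (?L n \<omega> + 1) * ?D n \<omega>"
      using L0[of n \<omega>] v theta_pos by auto
  next
    fix \<omega> n i assume vp: "valid_path \<theta> W S \<omega>" and i: "1 \<le> i" "i \<le> tables n \<omega>" "seats_at S n i \<omega>"
    interpret valid_path \<theta> W S \<omega> by (rule vp)
    show "?L (Suc n) \<omega> * exp (- v * clock (Suc n) \<omega>) \<le> (?L n \<omega> + of_bool (W i \<omega> < v)) * ?D n \<omega>"
      using L_Suc[OF vp i(1) _ i(3)] i(2) by (simp add: A_Suc algebra_simps)
  next
    fix \<omega> n assume vp: "valid_path \<theta> W S \<omega>" and i: "seats_at S n (tables n \<omega> + 1) \<omega>"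
    interpret valid_path \<theta> W S \<omega> by (rule vp)
    have "?L (Suc n) \<omega> \<le> ?L n \<omega> + 1" using L_Suc[OF vp _ _ i] by simp
    then show "?L (Suc n) \<omega> * exp (- v * clock (Suc n) \<omega>) \<le> (?L n \<omega> + 1) * ?D n \<omega>"
      unfolding A_Suc by (intro mult_right_mono) auto
  next
    fix \<omega> n assume vp: "valid_path \<theta> W S \<omega>"
    interpret valid_path \<theta> W S \<omega> by (rule vp)
    have "(\<Sum>i = 1..tables n \<omega>. W i \<omega> * real (S i n \<omega>) * of_bool (W i \<omega> < v)) \<le> v * light_customers v W S n \<omega>"
      unfolding light_customers_def sum_distrib_left
      by (intro sum_mono) (auto intro: mult_right_mono)
    then have light: "(\<Sum>i = 1..tables n \<omega>. W i \<omega> * real (S i n \<omega>) * of_bool (W i \<omega> < v)) + \<theta> \<le> v * ?L n \<omega>"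
      using v by (simp add: distrib_left)
    have "(\<Sum>i = 1..tables n \<omega>. W i \<omega> * real (S i n \<omega>) * ((?L n \<omega> + of_bool (W i \<omega> < v)) * ?D n \<omega>)) + \<theta> * ((?L n \<omega> + 1) * ?D n \<omega>)
      = (((\<Sum>i = 1..tables n \<omega>. W i \<omega> * real (S i n \<omega>)) + \<theta>) * ?L n \<omega> +
         ((\<Sum>i = 1..tables n \<omega>. W i \<omega> * real (S i n \<omega>) * of_bool (W i \<omega> < v)) + \<theta>)) * ?D n \<omega>"
    proof -
      \<comment> \<open>The algebra is isolated as an identity with free variables, into which the
        processes are substituted.\<close>
      have "(\<Sum>i = 1..k. c i * ((x + d i) * y)) + \<theta> * ((x + 1) * y)
        = (((\<Sum>i = 1..k. c i) + \<theta>) * x + ((\<Sum>i = 1..k. c i * d i) + \<theta>)) * y"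
        for c d :: "nat \<Rightarrow> real" and x y k
      proof -
        have "(\<Sum>i = 1..k. c i * ((x + d i) * y)) = ((\<Sum>i = 1..k. c i) * x + (\<Sum>i = 1..k. c i * d i)) * y"
          by (simp add: sum.distrib sum_distrib_left algebra_simps)
        then show ?thesis by (simp add: algebra_simps)
      qed
      then show ?thesis .
    qed
    also have "\<dots> \<le> (rate n \<omega> * ?L n \<omega> + v * ?L n \<omega>) * ?D n \<omega>"
      using light unfolding weighted_total by (intro mult_right_mono) auto
    also have "\<dots> = (rate n \<omega> + v) * (?L n \<omega> * ?D n \<omega>)" by (simp only: distrib_right mult.assoc)
    also have "\<dots> \<le> rate n \<omega> * exp (v * (1 / rate n \<omega>)) * (?L n \<omega> * ?D n \<omega>)"
      using L0[of n \<omega>] v theta_pos by (intro mult_right_mono one_plus_le_exp) auto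
    also have "\<dots> = rate n \<omega> * (?L n \<omega> * (exp (v * (1 / rate n \<omega>)) * ?D n \<omega>))" by (simp only: mult_ac)
    also have "exp (v * (1 / rate n \<omega>)) * ?D n \<omega> = exp (- v * clock n \<omega>)"
      unfolding exp_add[symmetric] by (simp add: algebra_simps)
    finally show "(\<Sum>i = 1..tables n \<omega>. W i \<omega> * real (S i n \<omega>) * ((?L n \<omega> + of_bool (W i \<omega> < v)) * ?D n \<omega>)) + \<theta> * ((?L n \<omega> + 1) * ?D n \<omega>)
      \<le> rate n \<omega> * (?L n \<omega> * exp (- v * clock n \<omega>))" .
  next
    fix \<omega> assume vp: "valid_path \<theta> W S \<omega>"
    interpret valid_path \<theta> W S \<omega> by (rule vp)
    have "light_customers v W S 0 \<omega> \<le> (\<Sum>i = 1..tables 0 \<omega>. real (S i 0 \<omega>))"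
      unfolding light_customers_def by (intro sum_mono) simp
    then have "light_customers v W S 0 \<omega> \<le> 1" unfolding Y_sum_real by simp
    then show "?L 0 \<omega> * exp (- v * clock 0 \<omega>) \<le> 1 + \<theta> / v"
      by (simp add: cum_rate_def)
  qed
qed

text \<open>With \<open>k\<close> customers at table \<open>j\<close>, an arrival there has
  probability \<open>W j * k / R\<close> and changes \<open>1 / k\<close> by
  \<open>- 1 / (k * (k + 1))\<close>. The conditional mean of \<open>1 / k\<close> thus shrinks by
  the factor \<open>1 - W j * k / ((k + 1) * R)\<close>, and \<open>k / (k + 1)\<close> is at least
  \<open>m / (m + 1)\<close>. The factor \<open>of_bool\<close> restricts to a start with
  \<open>m\<close> customers at time \<open>l\<close>.\<close>

lemma AE_bdd_table:
  assumes j: "1 \<le> j" and m: "1 \<le> m"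
  shows "AE \<omega> in M. \<exists>C. \<forall>n\<ge>l. of_bool (m \<le> S j l \<omega>) *
    (exp (real m / Suc m * W j \<omega> * (clock n \<omega> - clock l \<omega>)) / real (S j n \<omega>)) \<le> C"
proof -
  define a where "a \<omega> = real m / Suc m * W j \<omega>" for \<omega>
  let ?D = "\<lambda>n \<omega>. of_bool (m \<le> S j l \<omega>) * exp (a \<omega> * (clock n \<omega> + 1 / rate n \<omega> - clock l \<omega>))"
  have "AE \<omega> in M. \<exists>C. \<forall>n\<ge>l. of_bool (m \<le> S j l \<omega>) * (exp (a \<omega> * (clock n \<omega> - clock l \<omega>)) / real (S j n \<omega>)) \<le> C"
  proof (rule bounded_by_drift[where u = "\<lambda>n i \<omega>. ?D n \<omega> / (real (S j n \<omega>) + of_bool (i = j))"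
        and z = "\<lambda>n \<omega>. ?D n \<omega> / real (S j n \<omega>)" and c = 1])
    fix n assume n: "l \<le> n"
    note [measurable] = S_history[OF j n] S_history[OF j le_refl[of n]] W_history[OF j, of n]
      A_history[OF le_refl, of n] A_history[OF n] R_history[OF le_refl, of n]
    have [measurable]: "a \<in> borel_measurable (F n)" unfolding a_def by measurable
    show "(\<lambda>\<omega>. of_bool (m \<le> S j l \<omega>) * (exp (a \<omega> * (clock n \<omega> - clock l \<omega>)) / real (S j n \<omega>))) \<in> borel_measurable (F n)"
      "(\<lambda>\<omega>. ?D n \<omega> / real (S j n \<omega>)) \<in> borel_measurable (F n)" by measurable
    show "(\<lambda>\<omega>. ?D n \<omega> / (real (S j n \<omega>) + of_bool (i = j))) \<in> borel_measurable (F n)" for i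
      by measurable
  next
    fix \<omega> n i assume vp: "valid_path \<theta> W S \<omega>" and i: "seats_at S n i \<omega>"
    interpret valid_path \<theta> W S \<omega> by (rule vp)
    have "S j (Suc n) \<omega> = S j n \<omega> + of_bool (j = i)" using i j unfolding seats_at_def by blast
    then show "of_bool (m \<le> S j l \<omega>) * (exp (a \<omega> * (clock (Suc n) \<omega> - clock l \<omega>)) / real (S j (Suc n) \<omega>))
      \<le> ?D n \<omega> / (real (S j n \<omega>) + of_bool (i = j))" by (auto simp: A_Suc)
  next
    fix \<omega> n assume vp: "valid_path \<theta> W S \<omega>" and n: "l \<le> n" and i: "seats_at S n (tables n \<omega> + 1) \<omega>"
    interpret valid_path \<theta> W S \<omega> by (rule vp)
    show "of_bool (m \<le> S j l \<omega>) * (exp (a \<omega> * (clock (Suc n) \<omega> - clock l \<omega>)) / real (S j (Suc n) \<omega>))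
      \<le> ?D n \<omega> / real (S j n \<omega>)"
    proof (cases "m \<le> S j l \<omega>")
      case True
      \<comment> \<open>A table already holding customers is not the one that opens, so its count
        stays the same.\<close>
      then have "S j n \<omega> \<noteq> 0" using Y_mono[OF j n] m by simp
      then have "j \<noteq> tables n \<omega> + 1" using Y_nz[OF j, of n] by simp
      then have "S j (Suc n) \<omega> = S j n \<omega>" using i j unfolding seats_at_def by simp
      then show ?thesis by (simp add: A_Suc)
    qed simp
  next
    fix \<omega> n assume vp: "valid_path \<theta> W S \<omega>" and n: "l \<le> n"
    interpret valid_path \<theta> W S \<omega> by (rule vp)
    show "(\<Sum>i = 1..tables n \<omega>. W i \<omega> * real (S i n \<omega>) * (?D n \<omega> / (real (S j n \<omega>) + of_bool (i = j)))) + \<theta> * (?D n \<omega> / real (S j n \<omega>))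
      \<le> rate n \<omega> * (of_bool (m \<le> S j l \<omega>) * (exp (a \<omega> * (clock n \<omega> - clock l \<omega>)) / real (S j n \<omega>)))"
    proof (cases "m \<le> S j l \<omega>")
      case True
      define k where "k = real (S j n \<omega>)"
      define E where "E = exp (a \<omega> * (clock n \<omega> + 1 / rate n \<omega> - clock l \<omega>))"
      have mk: "real m \<le> k" "0 < k" using Y_mono[OF j n] m True by (auto simp: k_def)
      then have jK: "j \<in> {1..tables n \<omega>}" using Y_nz[OF j, of n] j by (auto simp: k_def)
      have E: "0 < E" by (simp add: E_def)
      \<comment> \<open>This splitting separates the single term \<open>i = j\<close> from a sum in
        which all tables have the same value.\<close>
      have "1 / (k + 1) = 1 / k - 1 / (k * (k + 1))" using mk by (simp add: divide_simps)
      then have frac: "1 / (k + of_bool (i = j)) = 1 / k - 1 / (k * (k + 1)) * of_bool (i = j)" for i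
        by simp
      have "W i \<omega> * real (S i n \<omega>) * (E / (k + of_bool (i = j))) =
        W i \<omega> * real (S i n \<omega>) * (E / k) - W i \<omega> * real (S i n \<omega>) * E / (k * (k + 1)) * of_bool (i = j)" for i
      proof -
        have "c * (E / (k + of_bool (i = j))) = c * E * (1 / (k + of_bool (i = j)))" for c by simp
        also have "c * E * (1 / (k + of_bool (i = j))) = c * (E / k) - c * E / (k * (k + 1)) * of_bool (i = j)" for c
          unfolding frac by (simp add: right_diff_distrib)
        finally show ?thesis .
      qed
      then have "(\<Sum>i = 1..tables n \<omega>. W i \<omega> * real (S i n \<omega>) * (E / (k + of_bool (i = j)))) =
        (rate n \<omega> - \<theta>) * (E / k) - W j \<omega> * k * E / (k * (k + 1))"
        by (simp only: sum_subtractf sum_distrib_right[symmetric] sum_of_bool_eq[OF jK] weighted_total k_def)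
      then have "(\<Sum>i = 1..tables n \<omega>. W i \<omega> * real (S i n \<omega>) * (E / (k + of_bool (i = j)))) + \<theta> * (E / k)
        = (rate n \<omega> - \<theta>) * (E / k) - W j \<omega> * k * E / (k * (k + 1)) + \<theta> * (E / k)" by (simp only:)
      also have "\<dots> = (rate n \<omega> - W j \<omega> * (k / (k + 1))) * (E / k)"
        using mk by (simp add: left_diff_distrib diff_divide_distrib)
      also have "\<dots> \<le> (rate n \<omega> + - a \<omega>) * (E / k)"
      proof -
        have "real m / Suc m \<le> k / (k + 1)" using mk by (simp add: field_simps)
        then have "a \<omega> \<le> W j \<omega> * (k / (k + 1))"
          unfolding a_def using W_pos[OF j]
          by (subst mult.commute, intro mult_left_mono) auto
        then show ?thesis using E mk by (intro mult_right_mono) auto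
      qed
      also have "\<dots> \<le> rate n \<omega> * exp (- a \<omega> * (1 / rate n \<omega>)) * (E / k)"
        using E mk by (intro mult_right_mono one_plus_le_exp) auto
      also have "\<dots> = rate n \<omega> * ((exp (- a \<omega> * (1 / rate n \<omega>)) * E) / k)" by simp
      also have "exp (- a \<omega> * (1 / rate n \<omega>)) * E = exp (a \<omega> * (clock n \<omega> - clock l \<omega>))"
        unfolding E_def exp_add[symmetric] by (simp add: algebra_simps)
      finally show ?thesis using True by (simp add: E_def k_def)
    qed simp
  next
    fix \<omega>
    show "of_bool (m \<le> S j l \<omega>) * (exp (a \<omega> * (clock l \<omega> - clock l \<omega>)) / real (S j l \<omega>)) \<le> 1"
      using m by (auto simp: divide_le_eq)
  qed auto
  then show ?thesis by (simp add: a_def)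
qed

section \<open>Assembly of the almost sure properties\<close>

text \<open>The parameters \<sigma>, \<open>q\<close>, \<open>j\<close>, \<open>m\<close>,
  \<open>l\<close> and the rational \<open>v\<close> range over countable sets, so the exceptional
  null sets can be united into one.\<close>

lemma AE_crp_path: "AE \<omega> in M. crp_path \<theta> W S \<omega> s"
proof -
  have 1: "AE \<omega> in M. \<forall>q::nat. \<forall>\<sigma>\<in>{1, -1}. \<exists>C. \<forall>n\<ge>0.
      exp (\<sigma> / Suc q * real (tables n \<omega>) - (exp (\<sigma> / Suc q) - 1) * \<theta> * clock n \<omega>) \<le> C"
    unfolding AE_all_countable by (intro allI AE_finite_allI AE_bdd_tables) auto
  have "AE \<omega> in M. 1 \<le> j \<longrightarrow> 1 \<le> m \<longrightarrow> (\<exists>C. \<forall>n\<ge>l. of_bool (m \<le> S j l \<omega>) *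
    (exp (real m / Suc m * W j \<omega> * (clock n \<omega> - clock l \<omega>)) / real (S j n \<omega>)) \<le> C)" for j m l
    using AE_bdd_table[of j m l] by (cases "1 \<le> j \<and> 1 \<le> m") auto
  then have 2: "AE \<omega> in M. \<forall>j m l. 1 \<le> j \<longrightarrow> 1 \<le> m \<longrightarrow> (\<exists>C. \<forall>n\<ge>l. of_bool (m \<le> S j l \<omega>) *
    (exp (real m / Suc m * W j \<omega> * (clock n \<omega> - clock l \<omega>)) / real (S j n \<omega>)) \<le> C)"
    by (simp add: AE_all_countable)
  have 3: "AE \<omega> in M. \<forall>v\<in>\<rat> \<inter> {0<..}. \<exists>C. \<forall>n\<ge>0. (light_customers v W S n \<omega> + \<theta> / v) * exp (- v * clock n \<omega>) \<le> C"
    by (intro AE_ball_countable' AE_bdd_light countable_Int1 countable_rat) auto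
  have 4: "AE \<omega> in M. \<forall>v\<in>\<rat> \<inter> {v. ereal v < s}. \<exists>j\<ge>1. v < W j \<omega>"
    by (intro AE_ball_countable' AE_exists_heavy countable_Int1 countable_rat) auto
  show ?thesis using AE_valid_path 1 2 3 4 AE_weights_less
  proof eventually_elim
    case (elim \<omega>)
    interpret valid_path \<theta> W S \<omega> by (rule elim(1))
    show ?case
    proof
      fix q :: nat and \<sigma> :: real assume "\<bar>\<sigma>\<bar> = 1"
      then have "\<sigma> \<in> {1, -1}" by auto
      then show "\<exists>C. \<forall>n. exp (\<sigma> / Suc q * real (tables n \<omega>) - (exp (\<sigma> / Suc q) - 1) * \<theta> * clock n \<omega>) \<le> C"
        using bspec[OF spec[OF elim(2), of q]] by (simp only: le0 simp_thms)
    next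
      fix j m l :: nat assume "1 \<le> j" "1 \<le> m" and m: "m \<le> S j l \<omega>"
      then have "\<exists>C. \<forall>n\<ge>l. of_bool (m \<le> S j l \<omega>) *
        (exp (real m / Suc m * W j \<omega> * (clock n \<omega> - clock l \<omega>)) / real (S j n \<omega>)) \<le> C" by (intro elim(3)[rule_format])
      then show "\<exists>C. \<forall>n\<ge>l. exp (real m / Suc m * W j \<omega> * (clock n \<omega> - clock l \<omega>)) / real (S j n \<omega>) \<le> C"
        using m by simp
    next
      fix v :: real assume "v \<in> \<rat>" "0 < v"
      then show "\<exists>C. \<forall>n. (light_customers v W S n \<omega> + \<theta> / v) * exp (- v * clock n \<omega>) \<le> C"
        using bspec[OF elim(4), of v] by simp
    next
      fix v :: real assume "v \<in> \<rat>" "ereal v < s"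
      then show "\<exists>j\<ge>1. v < W j \<omega>" using bspec[OF elim(5), of v] by simp
    next
      show "ereal (W i \<omega>) < s" if "1 \<le> i" for i using elim(6) that by blast
    qed
  qed
qed

end

theorem proposition1p1:
  fixes M :: "'a measure" and \<theta> :: real and \<mu> :: "real measure"
    and W :: "nat \<Rightarrow> 'a \<Rightarrow> real" and S :: "nat \<Rightarrow> nat \<Rightarrow> 'a \<Rightarrow> nat"
  assumes "\<theta> > 0"
    and "real_distribution \<mu>"
    and "AE w in \<mu>. 0 < w"
    and "measure \<mu> {w. ereal w = esssup \<mu> ereal} = 0"
    and "disordered_CRP M \<theta> \<mu> W S"
  shows
    "(AE \<omega> in M. (\<lambda>n. ereal (real (num_tables S n \<omega>) / ln (real n)))
        \<longlonglongrightarrow> ereal \<theta> / esssup \<mu> ereal) \<and>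
     (\<forall>k\<ge>1. AE \<omega> in M. filterlim (\<lambda>n. S k n \<omega>) at_top sequentially \<and>
        (\<lambda>n. real (S k n \<omega>) / real n) \<longlonglongrightarrow> 0) \<and>
     (\<forall>T :: nat \<Rightarrow> 'a \<Rightarrow> nat. (AE \<omega> in M. \<forall>n. most_occupied S n \<omega> (T n \<omega>)) \<longrightarrow>
        (AE \<omega> in M. filterlim (\<lambda>n. first_occupancy S (T n \<omega>) \<omega>) at_top sequentially)) \<and>
     (AE \<omega> in M. \<not> (\<lambda>n. Max ((\<lambda>i. real (S i n \<omega>) / real n) ` {1..})) \<longlonglongrightarrow> 1)"
proof -
  interpret positive_CRP M \<theta> \<mu> W S
    using assms by (simp add: positive_CRP_def positive_CRP_axioms_def)
  note path = AE_crp_path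
  show ?thesis
  proof (intro conjI allI impI)
    show "AE \<omega> in M. (\<lambda>n. ereal (real (num_tables S n \<omega>) / ln (real n)))
        \<longlonglongrightarrow> ereal \<theta> / esssup \<mu> ereal"
      using path by eventually_elim (rule crp_path.K_growth)
  next
    fix k :: nat assume "1 \<le> k"
    then show "AE \<omega> in M. filterlim (\<lambda>n. S k n \<omega>) at_top sequentially \<and>
        (\<lambda>n. real (S k n \<omega>) / real n) \<longlonglongrightarrow> 0"
      using path by (auto elim!: eventually_mono intro: crp_path.Y_at_top crp_path.proportion_vanishes)
  next
    \<comment> \<open>\<open>T\<close> is an arbitrary choice of a most occupied table at each time
      and outcome, so every way of breaking ties is covered.\<close>
    fix T :: "nat \<Rightarrow> 'a \<Rightarrow> nat"
    assume "AE \<omega> in M. \<forall>n. most_occupied S n \<omega> (T n \<omega>)"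
    with path show "AE \<omega> in M. filterlim (\<lambda>n. first_occupancy S (T n \<omega>) \<omega>) at_top sequentially"
    proof eventually_elim
      case (elim \<omega>)
      then show ?case by (intro crp_path.first_occupancy_at_top[of \<theta> W S \<omega> s "\<lambda>n. T n \<omega>"]) auto
    qed
  next
    show "AE \<omega> in M. \<not> (\<lambda>n. Max ((\<lambda>i. real (S i n \<omega>) / real n) ` {1..})) \<longlonglongrightarrow> 1"
      using path by eventually_elim (rule crp_path.max_proportion_not_to_1)
  qed
qed

end
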